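(* Let $r\ge1$, let $\vec n\in\mathbb Z_{\ge0}^r$ be a multi-index near the diagonal with $n:=|\vec n|\ge1$, and let $\vec a,\vec b\in\mathbb Z_{\ge0}^r$ satisfy $b_j\ge(n-n_1)\delta_{j,1}+a_j$ for $1\le j\le r$. Put $a_0=0$. For $1\le j\le r$, let $T_j$ be the size $(n+a_j)\times(n+a_{j-1})$ truncation (upper left corner) of a Haar distributed unitary matrix of size $(n+n_j+b_j)\times(n+n_j+b_j)$, with $T_1,\dots,T_r$ independent (the sizes being such that these truncations exist). Let $x_1,\dots,x_n$ be the squared singular values of $T_r\cdots T_1$. Then the average characteristic polynomial $\mathbb E\big[\prod_{j=1}^n(x-x_j)\big]$ equals the monic rescaling of the type II multiple orthogonal polynomial $P_{\vec n}(x;\vec a,\vec b)$.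
   Context: A multi-index $\vec n\in\mathbb Z_{\ge0}^r$ is near the diagonal if $|n_i-n_j|\le1$ for all $i,j$; $|\vec n|=n_1+\dots+n_r$; $\delta_{j,1}$ is the Kronecker delta. The squared singular values of the $(n+a_r)\times n$ matrix $Y=T_r\cdots T_1$ are the $n$ eigenvalues of $Y^\ast Y$. $P_{\vec n}(x;\vec a,\vec b)$ is, up to a non-zero constant, $$P_{\vec n}(x;\vec a,\vec b)={}_{r+1}F_r\left(\begin{array}{c}-|\vec n|,\ b_1+n_1+1,\dots,b_r+n_r+1\\ a_1+1,\dots,a_r+1\end{array};x\right),$$ which is the type II multiple orthogonal polynomial for the weights $w_1,\dots,w_r$ on $(0,1)$ with Mellin transforms $\int_0^1x^{s-1}w_j(x)dx=\frac1{s+b_j}\prod_{i=1}^r\frac{\Gamma(s+a_i)}{\Gamma(s+b_i)}$, i.e. $\int_0^1P_{\vec n}(x)x^kw_j(x)dx=0$ for $0\le k\le n_j-1$, $1\le j\le r$. *)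

theory Defs
  imports
    "HOL-Probability.Probability"
    "HOL-Computational_Algebra.Polynomial_FPS"
    "Jordan_Normal_Form.Schur_Decomposition"
begin

text \<open>
  Vectors of length \<open>r\<close> are functions on \<open>nat\<close> of which only the values at \<open>1, \<dots>, r\<close> matter.
  Matrices are those of \<open>Jordan_Normal_Form\<close> (indices start at 0), because their sizes vary
  with \<open>n\<close>, \<open>a\<close> and \<open>b\<close>.
\<close>

definition near_diagonal :: "nat \<Rightarrow> (nat \<Rightarrow> nat) \<Rightarrow> bool" where
  "near_diagonal r ns \<longleftrightarrow> (\<forall>i\<in>{1..r}. \<forall>j\<in>{1..r}. \<bar>int (ns i) - int (ns j)\<bar> \<le> 1)"

definition multi_index_size :: "nat \<Rightarrow> (nat \<Rightarrow> nat) \<Rightarrow> nat" where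
  "multi_index_size r ns = (\<Sum>j=1..r. ns j)"


text \<open>
  The Borel sets of the space of complex \<open>k \<times> l\<close> matrices, which is identified with a finite
  product of copies of the complex numbers through the matrix entries.
\<close>

definition mat_borel :: "nat \<Rightarrow> nat \<Rightarrow> complex mat measure" where
  "mat_borel k l =
     vimage_algebra (carrier_mat k l) (\<lambda>A. \<lambda>ij\<in>{..<k} \<times> {..<l}. A $$ ij)
       (\<Pi>\<^sub>M ij\<in>{..<k} \<times> {..<l}. borel)"

definition unitary_group :: "nat \<Rightarrow> complex mat set" where
  "unitary_group N = {U \<in> carrier_mat N N. mat_adjoint U * U = 1\<^sub>m N}"

definition unitary_borel :: "nat \<Rightarrow> complex mat measure" where
  "unitary_borel N = restrict_space (mat_borel N N) (unitary_group N)"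

text \<open>
  The unitary group is compact, so there is exactly one left-invariant Borel probability
  measure on it, and this measure is also right-invariant.
\<close>

definition haar_measure :: "nat \<Rightarrow> complex mat measure \<Rightarrow> bool" where
  "haar_measure N \<mu> \<longleftrightarrow>
     prob_space \<mu> \<and> sets \<mu> = sets (unitary_borel N) \<and>
     (\<forall>V\<in>unitary_group N. distr \<mu> \<mu> (\<lambda>U. V * U) = \<mu>)"

definition haar_distributed :: "'w measure \<Rightarrow> nat \<Rightarrow> ('w \<Rightarrow> complex mat) \<Rightarrow> bool" where
  "haar_distributed M N U \<longleftrightarrow>
     U \<in> measurable M (unitary_borel N) \<and> haar_measure N (distr M (unitary_borel N) U)"

definition truncation :: "nat \<Rightarrow> nat \<Rightarrow> 'a mat \<Rightarrow> 'a mat" where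
  "truncation k l A = Matrix.mat k l (\<lambda>(i, j). A $$ (i, j))"

text \<open>\<open>mat_product n T r\<close> is \<open>T r * \<dots> * T 1\<close>, where \<open>T 1\<close> has \<open>n\<close> columns.\<close>

primrec mat_product :: "nat \<Rightarrow> (nat \<Rightarrow> complex mat) \<Rightarrow> nat \<Rightarrow> complex mat" where
  "mat_product n T 0 = 1\<^sub>m n"
| "mat_product n T (Suc j) = T (Suc j) * mat_product n T j"

text \<open>
  The eigenvalues of \<open>Y\<^sup>* Y\<close>, repeated according to multiplicity. They are real, so \<open>Re\<close> only
  changes their type.
\<close>

definition squared_singular_values :: "complex mat \<Rightarrow> real multiset" where
  "squared_singular_values Y = image_mset Re (proots (char_poly (mat_adjoint Y * Y)))"


text \<open>
  The hypergeometric series terminates because of its numerator parameter \<open>- |n|\<close>: its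
  coefficients of index greater than \<open>|n|\<close> vanish, so the truncation loses nothing.
\<close>

definition mop_poly :: "nat \<Rightarrow> (nat \<Rightarrow> nat) \<Rightarrow> (nat \<Rightarrow> real) \<Rightarrow> (nat \<Rightarrow> real) \<Rightarrow> real poly" where
  "mop_poly r ns a b =
     truncate_fps (Suc (multi_index_size r ns))
       (fps_hypergeo
          (- real (multi_index_size r ns) # map (\<lambda>j. b j + real (ns j) + 1) [1..<Suc r])
          (map (\<lambda>j. a j + 1) [1..<Suc r]) 1)"

definition monic_rescaling :: "real poly \<Rightarrow> real poly" where
  "monic_rescaling p = Polynomial.smult (1 / lead_coeff p) p"

text \<open>
  The Mellin transforms are prescribed for all real \<open>s\<close> to the right of the poles \<open>- a i\<close>, which
  is where the integrals converge when \<open>b i \<ge> a i\<close> for all \<open>i\<close>.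
\<close>

definition mop_weights ::
  "nat \<Rightarrow> (nat \<Rightarrow> real) \<Rightarrow> (nat \<Rightarrow> real) \<Rightarrow> (nat \<Rightarrow> real \<Rightarrow> real) \<Rightarrow> bool" where
  "mop_weights r a b w \<longleftrightarrow>
     (\<forall>j\<in>{1..r}. \<forall>s. (\<forall>i\<in>{1..r}. s + a i > 0) \<longrightarrow>
        set_integrable lborel {0<..<1} (\<lambda>x. x powr (s - 1) * w j x) \<and>
        (LBINT x:{0<..<1}. x powr (s - 1) * w j x) =
          1 / (s + b j) * (\<Prod>i=1..r. Gamma (s + a i) / Gamma (s + b i)))"

definition type_II_mop ::
  "nat \<Rightarrow> (nat \<Rightarrow> nat) \<Rightarrow> (nat \<Rightarrow> real \<Rightarrow> real) \<Rightarrow> real poly \<Rightarrow> bool" where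
  "type_II_mop r ns w p \<longleftrightarrow>
     p \<noteq> 0 \<and> degree p \<le> multi_index_size r ns \<and>
     (\<forall>j\<in>{1..r}. \<forall>k<ns j. (LBINT x:{0<..<1}. poly p x * x ^ k * w j x) = 0)"

end

theory Submission
  imports Defs
begin

text \<open>
  Write \<open>Y = T r * \<dots> * T 1\<close>. The characteristic polynomial of \<open>Y\<^sup>* Y\<close> is an alternating sum of its
  principal minors, and by the Cauchy-Binet formula each of them is a sum of products of minors of
  the \<open>T j\<close> and their conjugates. Invariance of Haar measure under left multiplication by signed
  permutation matrices makes minors of a Haar unitary matrix with different row sets orthogonal, and
  the expected squared modulus of a \<open>k \<times> k\<close> minor is the inverse of a binomial coefficient. Hence
  \<open>Y\<^sup>* Y\<close> has, in expectation, the \<open>k\<close>-th elementary symmetric function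
  \<open>(n choose k) \<Prod>j. (n + a j choose k) / (n + ns j + b j choose k)\<close> of eigenvalues, which is a
  normalised coefficient of the hypergeometric polynomial. Near the diagonal, the integrals of that
  polynomial against \<open>x ^ k * w j x\<close> are \<open>n\<close>-th finite differences of polynomials of degree less
  than \<open>n\<close>.
\<close>

subsection \<open>Determinants over index sets\<close>

text \<open>The pairing \<open>minor_term\<close> is lopsided: a product of conjugated entries
  against a determinant, instead of a conjugated minor against a minor. Expansions then run over all
  maps from \<open>S\<close> to row indices rather than over sorted index sets; no ordering has to
  be chosen, and non-injective maps drop out because determinants with equal rows vanish. Falling
  factorials thus stand where the binomial coefficients would: injective maps are counted instead of
  subsets, and k! cancels in each quotient.

  The obstacle is that expanding \<open>T (Suc m)\<close> in a product leaves two unrelated row maps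
  \<open>p\<close> and \<open>q\<close> on the remaining factors. Orthogonality is therefore proved
  for pairs of row maps, with a 0/1 determinant recording the permutation that relates them.
  Combined with the entries of \<open>T (Suc m)\<close> and summed over \<open>q\<close>, this
  determinant turns into a \<open>minor_term\<close> of \<open>T (Suc m)\<close> alone, whose
  expectation is known. This closes the induction over the factors.\<close>

definition det_on :: "'i set \<Rightarrow> ('i \<Rightarrow> 'i \<Rightarrow> 'a :: comm_ring_1) \<Rightarrow> 'a" where
  "det_on S f = (\<Sum>\<pi> | \<pi> permutes S. of_int (sign \<pi>) * (\<Prod>i\<in>S. f i (\<pi> i)))"

lemma det_on_cong:
  assumes "\<And>i j. i \<in> S \<Longrightarrow> j \<in> S \<Longrightarrow> f i j = g i j"
  shows "det_on S f = det_on S g"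
  unfolding det_on_def
  by (intro sum.cong refl arg_cong2[where f = "(*)"] prod.cong)
     (auto intro!: assms simp: permutes_in_image)

lemma det_on_permute_rows:
  assumes "finite S" "\<rho> permutes S"
  shows "det_on S (\<lambda>i j. f (\<rho> i) j) = of_int (sign \<rho>) * det_on S f"
proof -
  have "det_on S (\<lambda>i j. f (\<rho> i) j) =
      (\<Sum>\<pi> | \<pi> permutes S. of_int (sign (\<pi> \<circ> \<rho>)) * (\<Prod>i\<in>S. f (\<rho> i) ((\<pi> \<circ> \<rho>) i)))"
    unfolding det_on_def by (rule sum_permutations_compose_right[OF assms(2)])
  also have "\<dots> = (\<Sum>\<pi> | \<pi> permutes S. of_int (sign \<rho>) * (of_int (sign \<pi>) * (\<Prod>i\<in>S. f i (\<pi> i))))"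
  proof (intro sum.cong refl)
    fix \<pi> assume "\<pi> \<in> {\<pi>. \<pi> permutes S}"
    then have "sign (\<pi> \<circ> \<rho>) = sign \<pi> * sign \<rho>"
      using assms by (intro sign_compose) (auto intro: permutation_permutes[THEN iffD2])
    moreover have "(\<Prod>i\<in>S. f (\<rho> i) ((\<pi> \<circ> \<rho>) i)) = (\<Prod>i\<in>S. f i (\<pi> i))"
      using prod.permute[OF assms(2), of "\<lambda>i. f i (\<pi> i)"] by (simp add: comp_def)
    ultimately show "of_int (sign (\<pi> \<circ> \<rho>)) * (\<Prod>i\<in>S. f (\<rho> i) ((\<pi> \<circ> \<rho>) i)) =
        of_int (sign \<rho>) * (of_int (sign \<pi>) * (\<Prod>i\<in>S. f i (\<pi> i)))"
      by simp
  qed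
  finally show ?thesis
    by (simp add: det_on_def sum_distrib_left)
qed

lemma det_on_permute_cols:
  assumes "finite S" "\<rho> permutes S"
  shows "det_on S (\<lambda>i j. f i (\<rho> j)) = of_int (sign \<rho>) * det_on S f"
proof -
  have "det_on S f =
      (\<Sum>\<pi> | \<pi> permutes S. of_int (sign (\<rho> \<circ> \<pi>)) * (\<Prod>i\<in>S. f i ((\<rho> \<circ> \<pi>) i)))"
    unfolding det_on_def by (rule setum_permutations_compose_left[OF assms(2)])
  also have "\<dots> = (\<Sum>\<pi> | \<pi> permutes S. of_int (sign \<rho>) * (of_int (sign \<pi>) * (\<Prod>i\<in>S. f i (\<rho> (\<pi> i)))))"
  proof (intro sum.cong refl)
    fix \<pi> assume "\<pi> \<in> {\<pi>. \<pi> permutes S}"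
    then have "sign (\<rho> \<circ> \<pi>) = sign \<rho> * sign \<pi>"
      using assms by (intro sign_compose) (auto intro: permutation_permutes[THEN iffD2])
    then show "of_int (sign (\<rho> \<circ> \<pi>)) * (\<Prod>i\<in>S. f i ((\<rho> \<circ> \<pi>) i)) =
        of_int (sign \<rho>) * (of_int (sign \<pi>) * (\<Prod>i\<in>S. f i (\<rho> (\<pi> i))))"
      by simp
  qed
  finally have "det_on S f = of_int (sign \<rho>) * det_on S (\<lambda>i j. f i (\<rho> j))"
    by (simp add: det_on_def sum_distrib_left)
  then have "of_int (sign \<rho>) * det_on S f =
      of_int (sign \<rho> * sign \<rho>) * det_on S (\<lambda>i j. f i (\<rho> j))"
    by (simp only: of_int_mult mult.assoc)
  then show ?thesis
    by (simp only: sign_idempotent of_int_1 mult_1)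
qed

text \<open>Swapping the two rows changes the sign of the determinant but not its entries.
  Characteristic zero without zero divisors turns \<open>x = - x\<close> into
  \<open>x = 0\<close>.\<close>

lemma det_on_equal_rows:
  fixes f :: "'i \<Rightarrow> 'i \<Rightarrow> 'a :: {comm_ring_1, ring_char_0, ring_no_zero_divisors}"
  assumes "finite S" "a \<in> S" "b \<in> S" "a \<noteq> b" "\<And>j. j \<in> S \<Longrightarrow> f a j = f b j"
  shows "det_on S f = 0"
proof -
  let ?t = "Transposition.transpose a b"
  have t: "?t permutes S"
    using assms by (intro permutes_swap_id)
  have "det_on S f = det_on S (\<lambda>i j. f (?t i) j)"
    by (rule det_on_cong) (use assms in \<open>auto simp: Transposition.transpose_def\<close>)
  also have "\<dots> = - det_on S f"
    using det_on_permute_rows[OF assms(1) t, of f] assms(4) by (simp add: sign_swap_id)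
  finally show ?thesis
    by (simp add: eq_neg_iff_add_eq_0 flip: mult_2)
qed

lemma det_on_equal_cols:
  fixes f :: "'i \<Rightarrow> 'i \<Rightarrow> 'a :: {comm_ring_1, ring_char_0, ring_no_zero_divisors}"
  assumes "finite S" "a \<in> S" "b \<in> S" "a \<noteq> b" "\<And>i. i \<in> S \<Longrightarrow> f i a = f i b"
  shows "det_on S f = 0"
proof -
  let ?t = "Transposition.transpose a b"
  have t: "?t permutes S"
    using assms by (intro permutes_swap_id)
  have "det_on S f = det_on S (\<lambda>i j. f i (?t j))"
    by (rule det_on_cong) (use assms in \<open>auto simp: Transposition.transpose_def\<close>)
  also have "\<dots> = - det_on S f"
    using det_on_permute_cols[OF assms(1) t, of f] assms(4) by (simp add: sign_swap_id)
  finally show ?thesis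
    by (simp add: eq_neg_iff_add_eq_0 flip: mult_2)
qed

lemma det_on_mult_rows:
  assumes "finite S"
  shows "det_on S (\<lambda>i j. c i * f i j) = (\<Prod>i\<in>S. c i) * det_on S f"
  unfolding det_on_def by (simp add: prod.distrib sum_distrib_left mult_ac)

text \<open>Multilinearity in the rows, the unsorted form of Cauchy-Binet: each row picks its own
  summation index. Grouping the injective maps \<open>l\<close> by their image would give the
  classical formula over subsets of \<open>X\<close>.\<close>

lemma det_on_sum_mult:
  assumes "finite S" "finite X"
  shows "det_on S (\<lambda>i j. \<Sum>x\<in>X. A i x * B x j) =
           (\<Sum>l\<in>S \<rightarrow>\<^sub>E X. (\<Prod>i\<in>S. A i (l i)) * det_on S (\<lambda>i j. B (l i) j))"
proof -
  have "det_on S (\<lambda>i j. \<Sum>x\<in>X. A i x * B x j) =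
      (\<Sum>\<pi> | \<pi> permutes S. \<Sum>l\<in>S \<rightarrow>\<^sub>E X. of_int (sign \<pi>) * (\<Prod>i\<in>S. A i (l i) * B (l i) (\<pi> i)))"
    unfolding det_on_def by (subst prod_sum_PiE) (use assms in \<open>auto simp: sum_distrib_left\<close>)
  also have "\<dots> = (\<Sum>l\<in>S \<rightarrow>\<^sub>E X. \<Sum>\<pi> | \<pi> permutes S. of_int (sign \<pi>) * (\<Prod>i\<in>S. A i (l i) * B (l i) (\<pi> i)))"
    by (rule sum.swap)
  also have "\<dots> = (\<Sum>l\<in>S \<rightarrow>\<^sub>E X. (\<Prod>i\<in>S. A i (l i)) * det_on S (\<lambda>i j. B (l i) j))"
    unfolding det_on_def by (simp add: prod.distrib sum_distrib_left mult_ac)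
  finally show ?thesis .
qed

text \<open>For injective \<open>l\<close> the matrix is the identity matrix on \<open>S\<close>, so
  only the identity permutation contributes.\<close>

lemma det_on_of_bool_inj:
  assumes "finite S" "inj_on l S"
  shows "det_on S (\<lambda>i j. of_bool (l i = l j)) = (1 :: 'a :: comm_ring_1)"
proof -
  have "(\<Prod>i\<in>S. of_bool (l i = l (\<pi> i)) :: 'a) = of_bool (\<pi> = id)" if "\<pi> permutes S" for \<pi>
  proof (cases "\<pi> = id")
    case False
    then obtain i where i: "\<pi> i \<noteq> i" by (auto simp: fun_eq_iff)
    then have "i \<in> S" using that by (auto simp: permutes_def)
    then have "l i \<noteq> l (\<pi> i)"
      using i that assms(2) by (auto simp: inj_on_def permutes_in_image)
    then show ?thesis
      using False \<open>i \<in> S\<close> assms(1) by (auto intro!: prod_zero)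
  qed simp
  then have "det_on S (\<lambda>i j. of_bool (l i = l j)) =
      (\<Sum>\<pi> | \<pi> permutes S. if \<pi> = id then 1 else 0 :: 'a)"
    unfolding det_on_def by (intro sum.cong) (auto simp: sign_id)
  then show ?thesis
    using assms(1) by (simp add: finite_permutations permutes_id)
qed

lemma det_on_of_bool:
  assumes "finite S"
  shows "det_on S (\<lambda>i j. of_bool (l i = l j)) =
    (of_bool (inj_on l S) :: 'a :: {comm_ring_1, ring_char_0, ring_no_zero_divisors})"
proof (cases "inj_on l S")
  case False
  then obtain a b where "a \<in> S" "b \<in> S" "a \<noteq> b" "l a = l b"
    by (auto simp: inj_on_def)
  then show ?thesis
    using False assms by (auto intro!: det_on_equal_rows[of S a b])
qed (use assms in \<open>simp add: det_on_of_bool_inj\<close>)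

text \<open>An injective map on \<open>insert s S\<close> is an injective map on \<open>S\<close>
  together with a value outside its image. If \<open>card S > card X\<close>, truncated subtraction
  produces a factor 0, so the count stays correct.\<close>

lemma card_inj_on_PiE:
  assumes "finite S" "finite X"
  shows "card {f \<in> S \<rightarrow>\<^sub>E X. inj_on f S} = (\<Prod>i<card S. card X - i)"
  using assms(1)
proof (induction S rule: finite_induct)
  case empty
  then show ?case by simp
next
  case (insert s S)
  let ?I = "{f \<in> S \<rightarrow>\<^sub>E X. inj_on f S}"
  have fin: "finite ?I"
    using insert(1) assms(2) by (auto intro!: finite_PiE)
  have "bij_betw (\<lambda>(f, y). f(s := y)) (SIGMA f:?I. X - f ` S)
      {f \<in> insert s S \<rightarrow>\<^sub>E X. inj_on f (insert s S)}"
  \<comment> \<open>The inverse has to reset the value at \<open>s\<close> to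
    \<open>undefined\<close>, because the elements of the extensional function space on
    \<open>S\<close> are undefined off \<open>S\<close>.\<close>
  proof (rule bij_betwI[where g = "\<lambda>f. (f(s := undefined), f s)"], goal_cases)
    have inj: "inj_on (f(s := y)) S \<longleftrightarrow> inj_on f S" for f :: "'a \<Rightarrow> 'b" and y
      using insert(2) by (intro inj_on_cong) auto
    have img: "f(s := y) ` S = f ` S" for f :: "'a \<Rightarrow> 'b" and y
      using insert(2) by (intro image_cong) auto
    have S: "insert s S - {s} = S" "S - {s} = S"
      using insert(2) by auto
    case 1
    show ?case
    proof (intro funcsetI, clarify)
      fix f y assume f: "f \<in> S \<rightarrow>\<^sub>E X" "inj_on f S" "y \<in> X" "y \<notin> f ` S"
      then have "inj_on (f(s := y)) (insert s S)"
        unfolding inj_on_insert S inj img by simp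
      then show "f(s := y) \<in> insert s S \<rightarrow>\<^sub>E X \<and> inj_on (f(s := y)) (insert s S)"
        using PiE_fun_upd[of y "\<lambda>_. X" s f S] f by simp
    qed
    case 2
    show ?case
    proof (rule funcsetI, elim CollectE conjE)
      fix f assume f: "f \<in> insert s S \<rightarrow>\<^sub>E X" "inj_on f (insert s S)"
      then have "inj_on f S" "f s \<notin> f ` S"
        unfolding inj_on_insert S by auto
      then show "(f(s := undefined), f s) \<in> (SIGMA f:?I. X - f ` S)"
        using f fun_upd_in_PiE[OF insert(2) f(1)] inj[of f undefined] img[of f undefined]
        using PiE_mem[OF f(1), of s] by (simp del: fun_upd_apply)
    qed
  next
    case (3 x)
    then show ?case using insert(2)
      by (auto simp: PiE_def extensional_def fun_eq_iff)
  next
    case (4 y)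
    then show ?case by auto
  qed
  then have "card {f \<in> insert s S \<rightarrow>\<^sub>E X. inj_on f (insert s S)} = card (SIGMA f:?I. X - f ` S)"
    by (rule bij_betw_same_card[symmetric])
  also have "\<dots> = (\<Sum>f\<in>?I. card (X - f ` S))"
    using fin assms(2) by (intro card_SigmaI) auto
  also have "\<dots> = (\<Sum>f\<in>?I. card X - card S)"
  proof (intro sum.cong refl)
    fix f assume "f \<in> ?I"
    then show "card (X - f ` S) = card X - card S"
      using insert(1) by (subst card_Diff_subset) (auto simp: card_image)
  qed
  also have "\<dots> = (\<Prod>i<card (insert s S). card X - i)"
    using insert by simp
  finally show ?case .
qed

text \<open>Each factor of the Leibniz formula is split into its entry of \<open>- A\<close> and its
  diagonal part; \<open>S\<close> collects the rows where the entry is chosen. On the complement of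
  \<open>S\<close> the diagonal part vanishes unless the permutation fixes the index, so only
  permutations of \<open>S\<close> survive.\<close>

lemma det_char_expansion:
  fixes A :: "'a :: comm_ring_1 mat"
  assumes "A \<in> carrier_mat n n"
  shows "det (x \<cdot>\<^sub>m 1\<^sub>m n - A) =
    (\<Sum>S\<in>Pow {0..<n}. (-1) ^ card S * x ^ (n - card S) * det_on S (\<lambda>i j. A $$ (i, j)))"
proof -
  let ?N = "{0..<n}"
  have "det (x \<cdot>\<^sub>m 1\<^sub>m n - A) =
      (\<Sum>\<pi> | \<pi> permutes ?N. of_int (sign \<pi>) * (\<Prod>i\<in>?N. - A $$ (i, \<pi> i) + x * of_bool (i = \<pi> i)))"
    using assms
    by (subst det_def', force)
       (intro sum.cong refl arg_cong2[where f = "(*)"] prod.cong, auto simp: permutes_in_image)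
  also have "\<dots> = (\<Sum>\<pi> | \<pi> permutes ?N. \<Sum>S\<in>Pow ?N.
      of_int (sign \<pi>) * ((\<Prod>i\<in>S. - A $$ (i, \<pi> i)) * (\<Prod>i\<in>?N - S. x * of_bool (i = \<pi> i))))"
    by (subst prod_add) (auto simp: sum_distrib_left)
  also have "\<dots> = (\<Sum>S\<in>Pow ?N. \<Sum>\<pi> | \<pi> permutes ?N.
      of_int (sign \<pi>) * ((\<Prod>i\<in>S. - A $$ (i, \<pi> i)) * (\<Prod>i\<in>?N - S. x * of_bool (i = \<pi> i))))"
    by (rule sum.swap)
  also have "\<dots> = (\<Sum>S\<in>Pow ?N. (-1) ^ card S * x ^ (n - card S) * det_on S (\<lambda>i j. A $$ (i, j)))"
  proof (intro sum.cong refl)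
    fix S assume S: "S \<in> Pow ?N"
    then have fin: "finite S" using finite_subset by auto
    have "(\<Sum>\<pi> | \<pi> permutes ?N.
        of_int (sign \<pi>) * ((\<Prod>i\<in>S. - A $$ (i, \<pi> i)) * (\<Prod>i\<in>?N - S. x * of_bool (i = \<pi> i)))) =
      (\<Sum>\<pi> | \<pi> permutes S.
        of_int (sign \<pi>) * ((\<Prod>i\<in>S. - A $$ (i, \<pi> i)) * (\<Prod>i\<in>?N - S. x * of_bool (i = \<pi> i))))"
    proof (intro sum.mono_neutral_right ballI)
      show "{\<pi>. \<pi> permutes S} \<subseteq> {\<pi>. \<pi> permutes ?N}"
        using S by (auto intro: permutes_subset)
      fix \<pi> assume \<pi>: "\<pi> \<in> {\<pi>. \<pi> permutes ?N} - {\<pi>. \<pi> permutes S}"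
      then obtain i where "i \<in> ?N - S" "\<pi> i \<noteq> i"
        using permutes_superset[of \<pi> ?N S] by auto
      then have "(\<Prod>i\<in>?N - S. x * of_bool (i = \<pi> i)) = 0"
        by (intro prod_zero) (auto intro!: bexI[of _ i])
      then show "of_int (sign \<pi>) * ((\<Prod>i\<in>S. - A $$ (i, \<pi> i)) * (\<Prod>i\<in>?N - S. x * of_bool (i = \<pi> i))) = 0"
        by (simp only: mult_zero_right)
    qed (simp add: finite_permutations)
    also have "\<dots> = (\<Sum>\<pi> | \<pi> permutes S.
        of_int (sign \<pi>) * (((-1) ^ card S * (\<Prod>i\<in>S. A $$ (i, \<pi> i))) * x ^ (n - card S)))"
    proof (intro sum.cong refl arg_cong2[where f = "(*)"])
      fix \<pi> assume \<pi>: "\<pi> \<in> {\<pi>. \<pi> permutes S}"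
      show "(\<Prod>i\<in>S. - A $$ (i, \<pi> i)) = (-1) ^ card S * (\<Prod>i\<in>S. A $$ (i, \<pi> i))"
        by (simp add: prod_uminus)
      have "(\<Prod>i\<in>?N - S. x * of_bool (i = \<pi> i)) = (\<Prod>i\<in>?N - S. x)"
        using \<pi> by (intro prod.cong) (auto simp: permutes_def)
      also have "\<dots> = x ^ (n - card S)"
        using S fin by (simp add: card_Diff_subset)
      finally show "(\<Prod>i\<in>?N - S. x * of_bool (i = \<pi> i)) = x ^ (n - card S)" .
    qed
    finally show "(\<Sum>\<pi> | \<pi> permutes ?N.
        of_int (sign \<pi>) * ((\<Prod>i\<in>S. - A $$ (i, \<pi> i)) * (\<Prod>i\<in>?N - S. x * of_bool (i = \<pi> i)))) =
      (-1) ^ card S * x ^ (n - card S) * det_on S (\<lambda>i j. A $$ (i, j))"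
      by (simp add: det_on_def sum_distrib_left mult_ac)
  qed
  finally show ?thesis .
qed

subsection \<open>Minors of Haar unitary matrices\<close>

text \<open>Boundedness is tracked in place of integrability because it is preserved by products. It
  suffices on probability spaces, and the entries of unitary matrices are bounded by 1.\<close>

definition bdd_measurable :: "'w measure \<Rightarrow> ('w \<Rightarrow> complex) \<Rightarrow> bool" where
  "bdd_measurable M f \<longleftrightarrow>
     f \<in> borel_measurable M \<and> (\<exists>B. \<forall>\<omega>\<in>space M. norm (f \<omega>) \<le> B)"

named_theorems bdd_measurable_intros

lemma bdd_measurableD: "bdd_measurable M f \<Longrightarrow> f \<in> borel_measurable M"
  by (simp add: bdd_measurable_def)

lemma bdd_measurable_cong:
  "(\<And>\<omega>. \<omega> \<in> space M \<Longrightarrow> f \<omega> = g \<omega>) \<Longrightarrow> bdd_measurable M f \<longleftrightarrow> bdd_measurable M g"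
  unfolding bdd_measurable_def using measurable_cong[of M f g borel] by auto

lemma bdd_measurable_const [bdd_measurable_intros]: "bdd_measurable M (\<lambda>_. c)"
  by (auto simp: bdd_measurable_def)

lemma bdd_measurable_mult [bdd_measurable_intros]:
  assumes "bdd_measurable M f" "bdd_measurable M g"
  shows "bdd_measurable M (\<lambda>x. f x * g x)"
proof -
  from assms obtain B C where "\<forall>\<omega>\<in>space M. norm (f \<omega>) \<le> B" "\<forall>\<omega>\<in>space M. norm (g \<omega>) \<le> C"
    by (auto simp: bdd_measurable_def)
  then have "\<forall>\<omega>\<in>space M. norm (f \<omega> * g \<omega>) \<le> B * C"
    unfolding norm_mult by (intro ballI mult_mono) (auto intro: order_trans[OF norm_ge_zero])
  then show ?thesis
    using assms by (auto simp: bdd_measurable_def)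
qed

lemma bdd_measurable_add [bdd_measurable_intros]:
  assumes "bdd_measurable M f" "bdd_measurable M g"
  shows "bdd_measurable M (\<lambda>x. f x + g x)"
proof -
  from assms obtain B C where "\<forall>\<omega>\<in>space M. norm (f \<omega>) \<le> B" "\<forall>\<omega>\<in>space M. norm (g \<omega>) \<le> C"
    by (auto simp: bdd_measurable_def)
  then have "\<forall>\<omega>\<in>space M. norm (f \<omega> + g \<omega>) \<le> B + C"
    by (meson add_mono norm_triangle_le)
  then show ?thesis
    using assms by (auto simp: bdd_measurable_def)
qed

lemma bdd_measurable_cnj [bdd_measurable_intros]:
  assumes "bdd_measurable M f"
  shows "bdd_measurable M (\<lambda>x. cnj (f x))"
proof -
  have "(\<lambda>x. cnj (f x)) \<in> borel_measurable M"
    using assms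
    by (intro borel_measurable_continuous_on[where f = cnj] continuous_intros) (auto simp: bdd_measurable_def)
  then show ?thesis
    using assms by (auto simp: bdd_measurable_def)
qed

lemma bdd_measurable_sum [bdd_measurable_intros]:
  "(\<And>i. i \<in> I \<Longrightarrow> bdd_measurable M (f i)) \<Longrightarrow> bdd_measurable M (\<lambda>x. \<Sum>i\<in>I. f i x)"
  by (induction I rule: infinite_finite_induct) (auto intro!: bdd_measurable_intros)

lemma bdd_measurable_prod [bdd_measurable_intros]:
  "(\<And>i. i \<in> I \<Longrightarrow> bdd_measurable M (f i)) \<Longrightarrow> bdd_measurable M (\<lambda>x. \<Prod>i\<in>I. f i x)"
  by (induction I rule: infinite_finite_induct) (auto intro!: bdd_measurable_intros)

lemma bdd_measurable_det_on [bdd_measurable_intros]: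
  assumes "\<And>i j. i \<in> S \<Longrightarrow> j \<in> S \<Longrightarrow> bdd_measurable M (f i j)"
  shows "bdd_measurable M (\<lambda>x. det_on S (\<lambda>i j. f i j x))"
  unfolding det_on_def
  by (intro bdd_measurable_intros assms) (auto simp: permutes_in_image)

lemma (in prob_space) bdd_measurable_integrable: "bdd_measurable M f \<Longrightarrow> integrable M f"
  unfolding bdd_measurable_def by (auto intro!: integrable_const_bound)

section \<open>Measurability of matrix entries and the unitary group\<close>

lemma space_mat_borel [simp]: "space (mat_borel k l) = carrier_mat k l"
  by (simp add: mat_borel_def)

lemma measurable_mat_entry:
  assumes "i < k" "j < l"
  shows "(\<lambda>A. A $$ (i, j)) \<in> borel_measurable (mat_borel k l)"
proof -
  have "(\<lambda>A. \<lambda>ij\<in>{..<k} \<times> {..<l}. A $$ ij) \<in>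
      mat_borel k l \<rightarrow>\<^sub>M (\<Pi>\<^sub>M ij\<in>{..<k} \<times> {..<l}. borel)"
    unfolding mat_borel_def by (rule measurable_vimage_algebra1) (auto simp: space_PiM)
  from measurable_compose[OF this measurable_component_singleton[of "(i, j)"]] assms
  show ?thesis by simp
qed

lemma measurable_mat_borelI:
  assumes "f \<in> space M \<rightarrow> carrier_mat k l"
    and "\<And>i j. i < k \<Longrightarrow> j < l \<Longrightarrow> (\<lambda>\<omega>. f \<omega> $$ (i, j)) \<in> borel_measurable M"
  shows "f \<in> M \<rightarrow>\<^sub>M mat_borel k l"
  unfolding mat_borel_def
  by (rule measurable_vimage_algebra2[OF assms(1)]) (auto intro!: measurable_restrict assms(2))

lemma mat_adjoint_dim [simp]:
  "dim_row (mat_adjoint A) = dim_col A" "dim_col (mat_adjoint A) = dim_row A"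
  by (auto simp: mat_adjoint_def)

lemma mat_adjoint_index [simp]:
  fixes A :: "complex mat"
  assumes "i < dim_col A" "j < dim_row A"
  shows "mat_adjoint A $$ (i, j) = cnj (A $$ (j, i))"
  using assms by (simp add: mat_adjoint_def mat_of_rows_index)

lemma adjoint_mult_index:
  fixes A :: "complex mat"
  assumes "A \<in> carrier_mat k l" "i < l" "j < l"
  shows "(mat_adjoint A * A) $$ (i, j) = (\<Sum>x<k. cnj (A $$ (x, i)) * A $$ (x, j))"
  using assms by (simp add: scalar_prod_def atLeast0LessThan)

lemma unitary_group_iff:
  "U \<in> unitary_group N \<longleftrightarrow> U \<in> carrier_mat N N \<and>
     (\<forall>i<N. \<forall>j<N. (\<Sum>x<N. cnj (U $$ (x, i)) * U $$ (x, j)) = of_bool (i = j))"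
proof (cases "U \<in> carrier_mat N N")
  case True
  have "mat_adjoint U * U = 1\<^sub>m N \<longleftrightarrow> (\<forall>i<N. \<forall>j<N. (mat_adjoint U * U) $$ (i, j) = of_bool (i = j))"
    using True by (auto simp: mat_eq_iff)
  then show ?thesis
    using True by (simp add: unitary_group_def adjoint_mult_index[OF True] del: index_mult_mat)
qed (simp add: unitary_group_def)

text \<open>Every column is a unit vector.\<close>

lemma unitary_group_entry_le_1:
  assumes "U \<in> unitary_group N" "i < N" "j < N"
  shows "norm (U $$ (i, j)) \<le> 1"
proof -
  have "complex_of_real (\<Sum>x<N. (norm (U $$ (x, j)))\<^sup>2) = (\<Sum>x<N. cnj (U $$ (x, j)) * U $$ (x, j))"
    unfolding of_real_sum by (intro sum.cong refl) (subst complex_norm_square, rule mult.commute)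
  also have "\<dots> = 1"
    using assms by (simp add: unitary_group_iff)
  finally have "(\<Sum>x<N. (norm (U $$ (x, j)))\<^sup>2) = 1"
    by (simp only: of_real_eq_1_iff)
  then have "(norm (U $$ (i, j)))\<^sup>2 \<le> 1"
    using member_le_sum[of i "{..<N}" "\<lambda>x. (norm (U $$ (x, j)))\<^sup>2"] assms by simp
  then show ?thesis
    by (simp add: power_le_one_iff)
qed

lemma unitary_group_mult:
  assumes "V \<in> unitary_group N" "U \<in> unitary_group N"
  shows "V * U \<in> unitary_group N"
proof -
  have V: "V \<in> carrier_mat N N" and U: "U \<in> carrier_mat N N"
    using assms by (auto simp: unitary_group_def)
  have adj: "mat_adjoint (V * U) = mat_adjoint U * mat_adjoint V"
    by (rule eq_matI) (use U V in \<open>auto simp: scalar_prod_def mult.commute\<close>)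
  have U': "mat_adjoint U \<in> carrier_mat N N" and V': "mat_adjoint V \<in> carrier_mat N N"
    using U V by auto
  have "mat_adjoint (V * U) * (V * U) = mat_adjoint U * ((mat_adjoint V * V) * U)"
    unfolding adj using U V U' V' by (simp add: assoc_mult_mat[of _ N N _ N _ N])
  also have "\<dots> = 1\<^sub>m N"
    using assms U by (simp add: unitary_group_def)
  finally show ?thesis
    using U V by (simp add: unitary_group_def)
qed

text \<open>Multiplication by this matrix from the left puts \<open>d i\<close> times row
  \<open>\<tau> i\<close> in place of row \<open>i\<close>. These are the group elements at which
  the invariance of Haar measure is evaluated: permutations identify the diagonal moments, signs
  kill the others.\<close>

definition signed_permutation_mat :: "nat \<Rightarrow> (nat \<Rightarrow> nat) \<Rightarrow> (nat \<Rightarrow> complex) \<Rightarrow> complex mat" where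
  "signed_permutation_mat N \<tau> d = mat N N (\<lambda>(i, j). of_bool (j = \<tau> i) * d i)"

lemma signed_permutation_mat_mult_index:
  assumes "\<tau> permutes {..<N}" "U \<in> carrier_mat N N" "i < N" "j < N"
  shows "(signed_permutation_mat N \<tau> d * U) $$ (i, j) = d i * U $$ (\<tau> i, j)"
proof -
  have "\<tau> i < N" using assms(1,3) permutes_in_image[OF assms(1), of i] by simp
  have "(signed_permutation_mat N \<tau> d * U) $$ (i, j) = (\<Sum>x<N. of_bool (x = \<tau> i) * d i * U $$ (x, j))"
    using assms by (simp add: signed_permutation_mat_def scalar_prod_def atLeast0LessThan)
  also have "\<dots> = (\<Sum>x<N. if x = \<tau> i then d i * U $$ (\<tau> i, j) else 0)"
    by (rule sum.cong) auto
  finally show ?thesis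
    using \<open>\<tau> i < N\<close> by simp
qed

lemma signed_permutation_mat_unitary:
  assumes "\<tau> permutes {..<N}" "\<And>i. i < N \<Longrightarrow> d i = 1 \<or> d i = -1"
  shows "signed_permutation_mat N \<tau> d \<in> unitary_group N"
proof -
  have "(\<Sum>x<N. cnj (signed_permutation_mat N \<tau> d $$ (x, i)) * signed_permutation_mat N \<tau> d $$ (x, j)) =
      of_bool (i = j)" if "i < N" "j < N" for i j
  proof -
    have "(\<Sum>x<N. cnj (signed_permutation_mat N \<tau> d $$ (x, i)) * signed_permutation_mat N \<tau> d $$ (x, j)) =
        (\<Sum>x<N. of_bool (i = \<tau> x) * of_bool (j = \<tau> x))"
    proof (intro sum.cong refl)
      fix x assume "x \<in> {..<N}"
      then have "cnj (d x) * d x = 1"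
        using assms(2)[of x] by auto
      then show "cnj (signed_permutation_mat N \<tau> d $$ (x, i)) * signed_permutation_mat N \<tau> d $$ (x, j) =
          of_bool (i = \<tau> x) * of_bool (j = \<tau> x)"
        using that \<open>x \<in> {..<N}\<close> by (simp add: signed_permutation_mat_def)
    qed
    also have "\<dots> = (\<Sum>x<N. of_bool (i = x) * of_bool (j = x))"
      by (rule sum.permute[OF assms(1), of "\<lambda>x. of_bool (i = x) * of_bool (j = x)", unfolded comp_def, symmetric])
    also have "\<dots> = (\<Sum>x<N. if x = i then of_bool (i = j) else 0)"
      by (rule sum.cong) auto
    finally show ?thesis using that by simp
  qed
  then show ?thesis
    by (auto simp: unitary_group_iff signed_permutation_mat_def)
qed

lemma space_unitary_borel [simp]: "space (unitary_borel N) = unitary_group N"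
  by (auto simp: unitary_borel_def space_restrict_space unitary_group_def)

lemma bdd_measurable_unitary_entry [bdd_measurable_intros]:
  assumes "i < N" "j < N"
  shows "bdd_measurable (unitary_borel N) (\<lambda>U. U $$ (i, j))"
proof -
  have "(\<lambda>U. U $$ (i, j)) \<in> borel_measurable (unitary_borel N)"
    unfolding unitary_borel_def by (intro measurable_restrict_space1 measurable_mat_entry assms)
  moreover have "\<forall>U\<in>space (unitary_borel N). norm (U $$ (i, j)) \<le> 1"
    using assms by (auto intro: unitary_group_entry_le_1)
  ultimately show ?thesis
    unfolding bdd_measurable_def by blast
qed

lemma measurable_unitary_mult:
  assumes "V \<in> unitary_group N"
  shows "(\<lambda>U. V * U) \<in> unitary_borel N \<rightarrow>\<^sub>M unitary_borel N"
  \<comment> \<open>The instance unfolds only the target space. The source stays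
    \<open>unitary_borel N\<close>, for which boundedness and measurability of the entries are
    available.\<close>
  unfolding unitary_borel_def[of N, THEN arg_cong[of _ _ "measurable (unitary_borel N)"]]
proof (rule measurable_restrict_space2)
  show "(\<lambda>U. V * U) \<in> space (unitary_borel N) \<rightarrow> unitary_group N"
    using assms by (auto intro: unitary_group_mult)
  have V: "V \<in> carrier_mat N N"
    using assms by (simp add: unitary_group_def)
  show "(\<lambda>U. V * U) \<in> unitary_borel N \<rightarrow>\<^sub>M mat_borel N N"
  proof (rule measurable_mat_borelI)
    fix i j assume ij: "i < N" "j < N"
    have "(\<lambda>U. \<Sum>x<N. V $$ (i, x) * U $$ (x, j)) \<in> borel_measurable (unitary_borel N)"
      using ij by (intro bdd_measurableD bdd_measurable_intros) auto
    also have "?this \<longleftrightarrow> (\<lambda>U. (V * U) $$ (i, j)) \<in> borel_measurable (unitary_borel N)"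
      using ij V
      by (intro measurable_cong) (auto simp: scalar_prod_def unitary_group_def atLeast0LessThan)
    finally show "(\<lambda>U. (V * U) $$ (i, j)) \<in> borel_measurable (unitary_borel N)" .
  qed (use V in \<open>auto simp: unitary_group_def\<close>)
qed

lemma haar_measure_integral_mult:
  fixes f :: "complex mat \<Rightarrow> complex"
  assumes "haar_measure N \<mu>" "V \<in> unitary_group N" "bdd_measurable (unitary_borel N) f"
  shows "(\<integral>U. f (V * U) \<partial>\<mu>) = (\<integral>U. f U \<partial>\<mu>)"
proof -
  have sets: "sets \<mu> = sets (unitary_borel N)" and inv: "distr \<mu> \<mu> (\<lambda>U. V * U) = \<mu>"
    using assms by (auto simp: haar_measure_def)
  have "(\<integral>U. f U \<partial>\<mu>) = (\<integral>U. f U \<partial>distr \<mu> \<mu> (\<lambda>U. V * U))"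
    by (simp only: inv)
  also have "\<dots> = (\<integral>U. f (V * U) \<partial>\<mu>)"
    using measurable_unitary_mult[OF assms(2)] bdd_measurableD[OF assms(3)]
    by (intro integral_distr) (simp_all cong: measurable_cong_sets add: sets)
  finally show ?thesis by simp
qed

section \<open>Orthogonality of minors\<close>

lemma ex_permutation_extending_inj:
  assumes "finite X" "inj_on f S" "inj_on g S" "f ` S \<subseteq> X" "g ` S \<subseteq> X"
  shows "\<exists>\<tau>. \<tau> permutes X \<and> (\<forall>i\<in>S. \<tau> (f i) = g i)"
proof -
  have "card (X - f ` S) = card (X - g ` S)"
    using assms by (simp add: card_Diff_subset card_image finite_subset[of _ X])
  \<comment> \<open>Off the prescribed images any bijection will do, since both complements have the
    same size.\<close>
  then obtain h where h: "bij_betw h (X - f ` S) (X - g ` S)"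
    using assms(1) finite_same_card_bij[of "X - f ` S" "X - g ` S"] by auto
  define \<tau> where "\<tau> x = (if x \<in> f ` S then g (inv_into S f x) else if x \<in> X then h x else x)" for x
  have "bij_betw (g \<circ> inv_into S f) (f ` S) (g ` S)"
    using assms by (intro bij_betw_trans[of _ _ S] bij_betw_inv_into) (auto simp: bij_betw_def)
  then have "bij_betw \<tau> (f ` S) (g ` S)"
    by (rule bij_betw_cong[THEN iffD1, rotated]) (simp add: \<tau>_def)
  moreover have "bij_betw \<tau> (X - f ` S) (X - g ` S)"
    using h by (rule bij_betw_cong[THEN iffD1, rotated]) (simp add: \<tau>_def)
  ultimately have "bij_betw \<tau> (f ` S \<union> (X - f ` S)) (g ` S \<union> (X - g ` S))"
    by (rule bij_betw_combine) auto
  moreover have "f ` S \<union> (X - f ` S) = X" "g ` S \<union> (X - g ` S) = X"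
    using assms by auto
  ultimately have "bij_betw \<tau> X X" by simp
  then have "\<tau> permutes X"
    using assms(4) by (intro bij_imp_permutes) (auto simp: \<tau>_def)
  moreover have "\<tau> (f i) = g i" if "i \<in> S" for i
    using that assms(2) by (simp add: \<tau>_def)
  ultimately show ?thesis by blast
qed

text \<open>Two row maps with the same image differ by a permutation of \<open>S\<close>; its sign
  is the sign by which the corresponding minors differ.\<close>

lemma ex_permutes_of_image_eq:
  assumes "finite S" "inj_on f S" "g ` S = f ` S"
  shows "\<exists>\<rho>. \<rho> permutes S \<and> (\<forall>i\<in>S. g i = f (\<rho> i))"
proof -
  have "inj_on g S"
    using assms by (metis card_image eq_card_imp_inj_on)
  define \<rho> where "\<rho> x = (if x \<in> S then inv_into S f (g x) else x)" for x
  have "bij_betw (inv_into S f \<circ> g) S S"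
    using assms \<open>inj_on g S\<close> by (intro bij_betw_trans[of _ _ "f ` S"] bij_betw_inv_into) (auto simp: bij_betw_def)
  then have "bij_betw \<rho> S S"
    by (rule bij_betw_cong[THEN iffD1, rotated]) (simp add: \<rho>_def)
  then have "\<rho> permutes S"
    by (rule bij_imp_permutes) (simp add: \<rho>_def)
  moreover have "g i = f (\<rho> i)" if "i \<in> S" for i
    using that f_inv_into_f[of "g i" f S] assms(3)[symmetric] by (simp add: \<rho>_def)
  ultimately show ?thesis by blast
qed

text \<open>A full minor, paired with only one of the \<open>card S\<close> factorial many terms of
  a conjugated minor. By \<open>det_on_sum_mult\<close>, the diagonal values \<open>l' = l\<close>
  summed over all maps \<open>l\<close> give the Gram determinant of the columns \<open>p\<close>
  exactly, without a factorial.\<close>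

definition minor_term ::
  "'i set \<Rightarrow> ('i \<Rightarrow> nat) \<Rightarrow> ('i \<Rightarrow> nat) \<Rightarrow> ('i \<Rightarrow> nat) \<Rightarrow> complex mat \<Rightarrow> complex" where
  "minor_term S l l' p U =
     (\<Prod>i\<in>S. cnj (U $$ (l i, p i))) * det_on S (\<lambda>i j. U $$ (l' i, p j))"

text \<open>
  The numerator on the right is the sign of the permutation of \<open>S\<close> that turns \<open>l\<close> into \<open>l'\<close>, and
  \<open>0\<close> if there is none or \<open>l\<close> is not injective.
\<close>

lemma haar_minor_term_expectation:
  assumes \<mu>: "haar_measure N \<mu>" and S: "finite S"
    and l: "l ` S \<subseteq> {..<N}" and l': "l' ` S \<subseteq> {..<N}" and p: "p ` S \<subseteq> {..<N}"
    and inj: "inj_on p S"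
  shows "(\<integral>U. minor_term S l l' p U \<partial>\<mu>) =
    det_on S (\<lambda>i j. of_bool (l' i = l j)) / (\<Prod>i<card S. of_nat (N - i))"
proof -
  interpret prob_space \<mu>
    using \<mu> by (simp add: haar_measure_def)
  have sets: "sets \<mu> = sets (unitary_borel N)"
    using \<mu> by (simp add: haar_measure_def)
  have space: "space \<mu> = unitary_group N"
    using sets_eq_imp_space_eq[OF sets] by simp
  define H where "H l l' = (\<integral>U. minor_term S l l' p U \<partial>\<mu>)" for l l'
  have bdd: "bdd_measurable (unitary_borel N) (minor_term S l l' p)"
    if "l ` S \<subseteq> {..<N}" "l' ` S \<subseteq> {..<N}" for l l'
    unfolding minor_term_def using that p
    by (intro bdd_measurable_intros) auto
  have int: "integrable \<mu> (minor_term S l l' p)" if "l ` S \<subseteq> {..<N}" "l' ` S \<subseteq> {..<N}" for l l'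
  proof (rule bdd_measurable_integrable)
    show "bdd_measurable \<mu> (minor_term S l l' p)"
      using bdd[OF that] unfolding bdd_measurable_def space measurable_cong_sets[OF sets refl] space_unitary_borel .
  qed
  \<comment> \<open>Haar invariance at a signed permutation matrix: the rows move along
    \<open>\<tau>\<close> and pick up signs, which are real and hence unaffected by
    conjugation.\<close>
  have invariance: "H l l' = (\<Prod>i\<in>S. d (l i)) * (\<Prod>i\<in>S. d (l' i)) * H (\<tau> \<circ> l) (\<tau> \<circ> l')"
    if \<tau>: "\<tau> permutes {..<N}" and d: "\<And>i. i < N \<Longrightarrow> d i = 1 \<or> d i = -1"
      and l: "l ` S \<subseteq> {..<N}" and l': "l' ` S \<subseteq> {..<N}" for \<tau> d l l'
  proof -
    let ?V = "signed_permutation_mat N \<tau> d"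
    have "H l l' = (\<integral>U. minor_term S l l' p (?V * U) \<partial>\<mu>)"
      unfolding H_def
      by (rule haar_measure_integral_mult[symmetric, OF \<mu> signed_permutation_mat_unitary bdd])
         (use \<tau> d l l' in auto)
    also have "\<dots> = (\<integral>U. (\<Prod>i\<in>S. d (l i)) * (\<Prod>i\<in>S. d (l' i)) * minor_term S (\<tau> \<circ> l) (\<tau> \<circ> l') p U \<partial>\<mu>)"
    proof (intro Bochner_Integration.integral_cong refl)
      fix U assume "U \<in> space \<mu>"
      then have U: "U \<in> carrier_mat N N"
        by (simp add: space unitary_group_def)
      have "(\<Prod>i\<in>S. cnj ((?V * U) $$ (l i, p i))) = (\<Prod>i\<in>S. d (l i) * cnj (U $$ (\<tau> (l i), p i)))"
      proof (intro prod.cong refl)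
        fix i assume i: "i \<in> S"
        then have "l i < N" "p i < N" using l p by auto
        moreover from this have "cnj (d (l i)) = d (l i)"
          using d[of "l i"] by auto
        ultimately show "cnj ((?V * U) $$ (l i, p i)) = d (l i) * cnj (U $$ (\<tau> (l i), p i))"
          by (simp only: signed_permutation_mat_mult_index[OF \<tau> U] complex_cnj_mult)
      qed
      moreover have "det_on S (\<lambda>i j. (?V * U) $$ (l' i, p j)) =
          det_on S (\<lambda>i j. d (l' i) * U $$ (\<tau> (l' i), p j))"
        by (rule det_on_cong, rule signed_permutation_mat_mult_index[OF \<tau> U]) (use l' p in auto)
      ultimately show "minor_term S l l' p (?V * U) =
          (\<Prod>i\<in>S. d (l i)) * (\<Prod>i\<in>S. d (l' i)) * minor_term S (\<tau> \<circ> l) (\<tau> \<circ> l') p U"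
        using S by (simp add: minor_term_def det_on_mult_rows prod.distrib mult_ac)
    qed
    finally show ?thesis
      by (simp add: H_def)
  qed
  have H_permute: "H l (\<lambda>i. l' (\<rho> i)) = of_int (sign \<rho>) * H l l'" if "\<rho> permutes S" for l l' \<rho>
  proof -
    have "minor_term S l (\<lambda>i. l' (\<rho> i)) p U = of_int (sign \<rho>) * minor_term S l l' p U" for U
      using det_on_permute_rows[OF S that, of "\<lambda>i j. U $$ (l' i, p j)"]
      by (simp add: minor_term_def)
    then show ?thesis
      by (simp add: H_def)
  qed
  have H_0: "H l l' = 0" if "\<not> inj_on l' S" for l l'
  proof -
    from that obtain a b where "a \<in> S" "b \<in> S" "a \<noteq> b" "l' a = l' b"
      by (auto simp: inj_on_def)
    then have "minor_term S l l' p U = 0" for U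
      by (simp add: minor_term_def det_on_equal_rows[of S a b] S)
    then show ?thesis by (simp add: H_def)
  qed
  have H_const: "H l l = H p p" if l: "l ` S \<subseteq> {..<N}" "inj_on l S" for l
  proof -
    obtain \<tau> where \<tau>: "\<tau> permutes {..<N}" "\<forall>i\<in>S. \<tau> (l i) = p i"
      using ex_permutation_extending_inj[of "{..<N}" l S p] l p inj by auto
    have "H l l = H (\<tau> \<circ> l) (\<tau> \<circ> l)"
      using invariance[OF \<tau>(1), of "\<lambda>_. 1" l l] l by simp
    also have "\<dots> = H p p"
    proof -
      have "minor_term S (\<tau> \<circ> l) (\<tau> \<circ> l) p = minor_term S p p p"
        using \<tau>(2) unfolding minor_term_def fun_eq_iff
        by (intro allI arg_cong2[where f = "(*)"] prod.cong det_on_cong) auto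
      then show ?thesis by (simp only: H_def)
    qed
    finally show ?thesis .
  qed
  \<comment> \<open>This fixes the normalisation. The diagonal terms add up to the Gram determinant
    of distinct orthonormal columns, which is 1 for every \<open>U\<close>; on the left all
    injective \<open>l\<close> contribute equally.\<close>
  have "(\<Sum>l\<in>S \<rightarrow>\<^sub>E {..<N}. H l l) = (\<integral>U. (\<Sum>l\<in>S \<rightarrow>\<^sub>E {..<N}. minor_term S l l p U) \<partial>\<mu>)"
    unfolding H_def by (rule Bochner_Integration.integral_sum[symmetric], rule int) (auto simp: PiE_def)
  also have "\<dots> = (\<integral>U. 1 \<partial>\<mu>)"
  proof (intro Bochner_Integration.integral_cong refl)
    fix U assume "U \<in> space \<mu>"
    then have U: "U \<in> unitary_group N"
      by (simp add: space)
    have "(\<Sum>l\<in>S \<rightarrow>\<^sub>E {..<N}. minor_term S l l p U) =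
        det_on S (\<lambda>i j. \<Sum>x<N. cnj (U $$ (x, p i)) * U $$ (x, p j))"
      unfolding minor_term_def by (rule det_on_sum_mult[symmetric]) (use S in auto)
    also have "\<dots> = det_on S (\<lambda>i j. of_bool (p i = p j))"
      using U p by (intro det_on_cong) (simp add: unitary_group_iff image_subset_iff)
    also have "\<dots> = 1"
      using S inj by (rule det_on_of_bool_inj)
    finally show "(\<Sum>l\<in>S \<rightarrow>\<^sub>E {..<N}. minor_term S l l p U) = 1" .
  qed
  also have "\<dots> = 1"
    by (simp add: prob_space)
  finally have "1 = (\<Sum>l\<in>S \<rightarrow>\<^sub>E {..<N}. H l l)" ..
  also have "\<dots> = (\<Sum>l\<in>S \<rightarrow>\<^sub>E {..<N}. if inj_on l S then H p p else 0)"
    using H_const H_0 by (intro sum.cong refl) (auto simp: PiE_def)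
  also have "\<dots> = of_nat (card {l \<in> S \<rightarrow>\<^sub>E {..<N}. inj_on l S}) * H p p"
    using S by (simp add: sum.If_cases Int_def finite_PiE)
  also have "\<dots> = (\<Prod>i<card S. of_nat (N - i)) * H p p"
    using S by (simp add: card_inj_on_PiE)
  finally have "1 = (\<Prod>i<card S. of_nat (N - i)) * H p p" .
  \<comment> \<open>That the falling factorial is nonzero is read off from the equation itself,
    whose left-hand side is 1.\<close>
  then have Hpp: "H p p = 1 / (\<Prod>i<card S. of_nat (N - i))"
    by (metis mult_zero_left nonzero_eq_divide_eq mult.commute zero_neq_one)
  consider "\<not> inj_on l' S" | "inj_on l' S" "l' ` S \<noteq> l ` S" | "inj_on l' S" "l' ` S = l ` S"
    by blast
  then have "H l l' = det_on S (\<lambda>i j. of_bool (l' i = l j)) / (\<Prod>i<card S. of_nat (N - i))"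
  proof cases
    case 1
    then obtain a b where "a \<in> S" "b \<in> S" "a \<noteq> b" "l' a = l' b"
      by (auto simp: inj_on_def)
    then have "det_on S (\<lambda>i j. of_bool (l' i = l j) :: complex) = 0"
      by (intro det_on_equal_rows[of S a b] S) auto
    then show ?thesis
      using H_0[OF 1] by simp
  next
    case 2
    have "card (l ` S) \<le> card (l' ` S)"
      using 2(1) S by (simp add: card_image card_image_le)
    then have "\<not> l' ` S \<subseteq> l ` S"
      using 2(2) S by (metis card_seteq finite_imageI)
    then obtain i0 where i0: "i0 \<in> S" "l' i0 \<notin> l ` S" by auto
    \<comment> \<open>Flip the sign of row \<open>l' i0\<close> only. It occurs once among the rows
      \<open>l'\<close> and not among the rows \<open>l\<close>, so invariance gives
      \<open>H l l' = - H l l'\<close>.\<close>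
    define d :: "nat \<Rightarrow> complex" where "d x = (if x = l' i0 then -1 else 1)" for x
    have "l i \<noteq> l' i0" if "i \<in> S" for i
      using i0(2) imageI[OF that, of l] by metis
    then have "(\<Prod>i\<in>S. d (l i)) = 1"
      by (intro prod.neutral) (simp add: d_def)
    moreover have "(\<Prod>i\<in>S. d (l' i)) = (\<Prod>i\<in>S. if i = i0 then -1 else 1)"
      using 2(1) i0 by (intro prod.cong) (auto simp: d_def inj_on_def)
    then have "(\<Prod>i\<in>S. d (l' i)) = -1"
      using i0 S by (simp add: prod.delta)
    ultimately have "H l l' = - H l l'"
      using invariance[OF permutes_id, of d l l'] l l' by (simp add: d_def)
    then have "H l l' = 0"
      by (simp add: eq_neg_iff_add_eq_0 flip: mult_2)
    \<comment> \<open>Row \<open>i0\<close> of the 0/1 matrix is zero, because \<open>l' i0\<close>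
      is not a value of \<open>l\<close>.\<close>
    moreover have "det_on S (\<lambda>i j. of_bool (l' i = l j) :: complex) = 0"
      unfolding det_on_def
    proof (intro sum.neutral ballI)
      fix \<pi> assume "\<pi> \<in> {\<pi>. \<pi> permutes S}"
      then have "l (\<pi> i0) \<in> l ` S"
        using i0 by (simp add: permutes_in_image)
      then have "(\<Prod>i\<in>S. of_bool (l' i = l (\<pi> i)) :: complex) = 0"
        using i0 S by (intro prod_zero bexI[of _ i0]) auto
      then show "of_int (sign \<pi>) * (\<Prod>i\<in>S. of_bool (l' i = l (\<pi> i)) :: complex) = 0"
        by simp
    qed
    ultimately show ?thesis by simp
  next
    case 3
    have "inj_on l S"
      using 3 S by (metis card_image eq_card_imp_inj_on)
    obtain \<rho> where \<rho>: "\<rho> permutes S" "\<forall>i\<in>S. l' i = l (\<rho> i)"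
      using ex_permutes_of_image_eq[OF S \<open>inj_on l S\<close> 3(2)] by blast
    have "minor_term S l l' p = minor_term S l (\<lambda>i. l (\<rho> i)) p"
      unfolding minor_term_def fun_eq_iff
      by (intro allI arg_cong2[where f = "(*)"] prod.cong det_on_cong) (simp_all add: \<rho>(2))
    then have "H l l' = of_int (sign \<rho>) * H p p"
      using H_permute[OF \<rho>(1), of l l] H_const[OF l \<open>inj_on l S\<close>] by (simp add: H_def)
    moreover have "det_on S (\<lambda>i j. of_bool (l' i = l j) :: complex) =
        det_on S (\<lambda>i j. of_bool (l (\<rho> i) = l j))"
      by (rule det_on_cong) (simp add: \<rho>(2))
    then have "det_on S (\<lambda>i j. of_bool (l' i = l j) :: complex) = of_int (sign \<rho>)"
      using det_on_permute_rows[OF S \<rho>(1), of "\<lambda>i j. of_bool (l i = l j) :: complex"]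
        det_on_of_bool_inj[OF S \<open>inj_on l S\<close>, where ?'a = complex] by simp
    ultimately show ?thesis
      by (simp add: Hpp)
  qed
  then show ?thesis
    by (simp add: H_def)
qed

subsection \<open>Products of independent matrices\<close>

text \<open>The conjugated product is expanded by distributivity, with index map \<open>p\<close>,
  and the determinant row by row, with index map \<open>q\<close>. The right factor keeps a
  \<open>minor_term\<close> for the pair \<open>p\<close>, \<open>q\<close>; the left factor
  contributes only a product of entries, which suits independence.\<close>

lemma minor_term_mult:
  assumes "A \<in> carrier_mat m k" "B \<in> carrier_mat k n" "finite S"
    and "l ` S \<subseteq> {..<m}" "l' ` S \<subseteq> {..<m}" "p0 ` S \<subseteq> {..<n}"
  shows "minor_term S l l' p0 (A * B) =
    (\<Sum>p\<in>S \<rightarrow>\<^sub>E {..<k}. \<Sum>q\<in>S \<rightarrow>\<^sub>E {..<k}.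
       minor_term S p q p0 B * ((\<Prod>i\<in>S. cnj (A $$ (l i, p i))) * (\<Prod>i\<in>S. A $$ (l' i, q i))))"
proof -
  have entry: "(A * B) $$ (i, j) = (\<Sum>x<k. A $$ (i, x) * B $$ (x, j))" if "i < m" "j < n" for i j
    using that assms(1,2) by (simp add: scalar_prod_def atLeast0LessThan)
  have "(\<Prod>i\<in>S. cnj ((A * B) $$ (l i, p0 i))) = (\<Prod>i\<in>S. \<Sum>x<k. cnj (A $$ (l i, x)) * cnj (B $$ (x, p0 i)))"
    by (intro prod.cong refl, subst entry) (use assms in auto)
  also have "\<dots> = (\<Sum>p\<in>S \<rightarrow>\<^sub>E {..<k}. \<Prod>i\<in>S. cnj (A $$ (l i, p i)) * cnj (B $$ (p i, p0 i)))"
    by (rule prod_sum_PiE) (use assms in auto)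
  finally have 1: "(\<Prod>i\<in>S. cnj ((A * B) $$ (l i, p0 i))) =
    (\<Sum>p\<in>S \<rightarrow>\<^sub>E {..<k}. (\<Prod>i\<in>S. cnj (A $$ (l i, p i))) * (\<Prod>i\<in>S. cnj (B $$ (p i, p0 i))))"
    by (simp add: prod.distrib)
  have "det_on S (\<lambda>i j. (A * B) $$ (l' i, p0 j)) = det_on S (\<lambda>i j. \<Sum>x<k. A $$ (l' i, x) * B $$ (x, p0 j))"
    by (rule det_on_cong, rule entry) (use assms in auto)
  also have "\<dots> = (\<Sum>q\<in>S \<rightarrow>\<^sub>E {..<k}. (\<Prod>i\<in>S. A $$ (l' i, q i)) * det_on S (\<lambda>i j. B $$ (q i, p0 j)))"
    by (rule det_on_sum_mult) (use assms in auto)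
  finally have 2: "det_on S (\<lambda>i j. (A * B) $$ (l' i, p0 j)) =
    (\<Sum>q\<in>S \<rightarrow>\<^sub>E {..<k}. (\<Prod>i\<in>S. A $$ (l' i, q i)) * det_on S (\<lambda>i j. B $$ (q i, p0 j)))" .
  show ?thesis
    unfolding minor_term_def 1 2 sum_product by (intro sum.cong refl) (simp add: mult_ac)
qed

text \<open>Expands \<open>A\<close> as \<open>A\<close> times an identity matrix. It is read from
  right to left later: the 0/1 determinant that orthogonality produces for the right factor of a
  product is absorbed into a \<open>minor_term\<close> of the left factor.\<close>

lemma minor_term_conv_sum:
  assumes "finite S"
    and "p ` S \<subseteq> {..<k}"
  shows "minor_term S l l' p A =
    (\<Sum>q\<in>S \<rightarrow>\<^sub>E {..<k}. det_on S (\<lambda>i j. of_bool (q i = p j)) *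
       ((\<Prod>i\<in>S. cnj (A $$ (l i, p i))) * (\<Prod>i\<in>S. A $$ (l' i, q i))))"
proof -
  have "det_on S (\<lambda>i j. A $$ (l' i, p j)) = det_on S (\<lambda>i j. \<Sum>x<k. A $$ (l' i, x) * of_bool (x = p j))"
  proof (rule det_on_cong)
    fix i j assume "i \<in> S" "j \<in> S"
    have "(\<Sum>x<k. A $$ (l' i, x) * of_bool (x = p j)) = (\<Sum>x<k. if x = p j then A $$ (l' i, p j) else 0)"
      by (rule sum.cong) auto
    then show "A $$ (l' i, p j) = (\<Sum>x<k. A $$ (l' i, x) * of_bool (x = p j))"
      using \<open>j \<in> S\<close> assms(2) by auto
  qed
  also have "\<dots> = (\<Sum>q\<in>S \<rightarrow>\<^sub>E {..<k}. (\<Prod>i\<in>S. A $$ (l' i, q i)) * det_on S (\<lambda>i j. of_bool (q i = p j)))"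
    by (rule det_on_sum_mult) (use assms in auto)
  finally show ?thesis
    by (simp add: minor_term_def sum_distrib_left mult_ac)
qed

text \<open>The empty product already has the shape that the induction preserves: a weight depending
  on \<open>l\<close> times the 0/1 determinant relating \<open>l'\<close> to
  \<open>l\<close>.\<close>

lemma minor_term_one:
  assumes "finite S" "S \<subseteq> {..<n}" "l ` S \<subseteq> {..<n}" "l' ` S \<subseteq> {..<n}"
  shows "minor_term S l l' (\<lambda>i. i) (1\<^sub>m n) =
    of_bool (\<forall>i\<in>S. l i = i) * det_on S (\<lambda>i j. of_bool (l' i = l j))"
proof (cases "\<forall>i\<in>S. l i = i")
  case True
  then have "(\<Prod>i\<in>S. cnj (1\<^sub>m n $$ (l i, i)) :: complex) = 1"
    using assms(2) by (intro prod.neutral) auto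
  moreover have "det_on S (\<lambda>i j. 1\<^sub>m n $$ (l' i, j) :: complex) = det_on S (\<lambda>i j. of_bool (l' i = l j))"
    using True assms(2,4) by (intro det_on_cong) (simp add: image_subset_iff subset_iff)
  ultimately show ?thesis
    using True by (simp add: minor_term_def)
next
  case False
  then obtain i where "i \<in> S" "l i \<noteq> i" by auto
  then have "(\<Prod>i\<in>S. cnj (1\<^sub>m n $$ (l i, i)) :: complex) = 0"
    using assms by (intro prod_zero bexI[of _ i]) (simp_all add: image_subset_iff subset_iff)
  then show ?thesis
    using False by (simp add: minor_term_def)
qed

text \<open>The scalar in front of the 0/1 determinant for the product of the first \<open>m\<close>
  factors. It depends on \<open>l\<close> only for \<open>m = 0\<close>, where the product is the
  identity matrix and rows must equal columns.\<close>

primrec minor_weight :: "nat set \<Rightarrow> (nat \<Rightarrow> nat) \<Rightarrow> (nat \<Rightarrow> complex) \<Rightarrow> nat \<Rightarrow> (nat \<Rightarrow> nat) \<Rightarrow> complex" where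
  "minor_weight S d c 0 l = of_bool (\<forall>i\<in>S. l i = i)"
| "minor_weight S d c (Suc m) l =
     c (Suc m) * (\<Sum>p\<in>S \<rightarrow>\<^sub>E {..<d m}. of_bool (inj_on p S) * minor_weight S d c m p)"

text \<open>At a positive level the weight is constant in the row map, so summing over injective
  maps multiplies it by their number, a falling factorial of \<open>d j\<close>. At level 0 a single
  map contributes, which is why \<open>d 0\<close> yields no factor.\<close>

lemma sum_minor_weight:
  assumes "finite S" "S \<subseteq> {..<d 0}"
  shows "(\<Sum>p\<in>S \<rightarrow>\<^sub>E {..<d m}. of_bool (inj_on p S) * minor_weight S d c m p) =
    (\<Prod>j=1..m. c j * (\<Prod>i<card S. of_nat (d j - i)))"
proof (induction m)
  case 0
  have "(\<Sum>p\<in>S \<rightarrow>\<^sub>E {..<d 0}. of_bool (inj_on p S) * minor_weight S d c 0 p) =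
      (\<Sum>p\<in>S \<rightarrow>\<^sub>E {..<d 0}. if p = restrict (\<lambda>i. i) S then 1 else 0)"
  proof (intro sum.cong refl)
    fix p assume "p \<in> S \<rightarrow>\<^sub>E {..<d 0}"
    then have "(\<forall>i\<in>S. p i = i) \<longleftrightarrow> p = restrict (\<lambda>i. i) S"
      by (auto simp: fun_eq_iff PiE_def extensional_def)
    moreover have "inj_on (restrict (\<lambda>i. i) S) S"
      by (simp add: inj_on_def)
    ultimately show "of_bool (inj_on p S) * minor_weight S d c 0 p =
        (if p = restrict (\<lambda>i. i) S then 1 else 0)"
      by auto
  qed
  also have "\<dots> = 1"
    using assms by (subst sum.delta) (auto intro!: finite_PiE)
  finally show ?case by simp
next
  case (Suc m)
  let ?w = "c (Suc m) * (\<Sum>p\<in>S \<rightarrow>\<^sub>E {..<d m}. of_bool (inj_on p S) * minor_weight S d c m p)"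
  have "(\<Sum>p\<in>S \<rightarrow>\<^sub>E {..<d (Suc m)}. of_bool (inj_on p S) * minor_weight S d c (Suc m) p) =
      (\<Sum>p\<in>S \<rightarrow>\<^sub>E {..<d (Suc m)}. if inj_on p S then ?w else 0)"
    by (intro sum.cong refl) simp
  also have "\<dots> = of_nat (card {p \<in> S \<rightarrow>\<^sub>E {..<d (Suc m)}. inj_on p S}) * ?w"
    using assms(1) by (simp add: sum.If_cases Int_def finite_PiE del: minor_weight.simps)
  also have "\<dots> = (\<Prod>j=1..Suc m. c j * (\<Prod>i<card S. of_nat (d j - i)))"
    using assms(1) by (simp add: card_inj_on_PiE Suc.IH)
  finally show ?case .
qed

lemma mat_product_carrier:
  assumes "\<And>j. j \<in> {1..m} \<Longrightarrow> T j \<in> carrier_mat (d j) (d (j - 1))"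
  shows "mat_product (d 0) T m \<in> carrier_mat (d m) (d 0)"
  using assms
proof (induction m)
  case (Suc m)
  then have "mat_product (d 0) T m \<in> carrier_mat (d m) (d 0)" "T (Suc m) \<in> carrier_mat (d (Suc m)) (d m)"
    using Suc.prems[of "Suc m"] by auto
  then show ?case by simp
qed simp

text \<open>Isolates what the product formula needs from the random factors: independence, bounded
  entries and the expectations of minor terms. In the application \<open>c j\<close> is the
  reciprocal falling factorial of the size of the unitary matrix; it depends on \<open>S\<close>
  through its cardinality, so \<open>S\<close> is fixed in the locale.\<close>

locale independent_minors = prob_space M for M :: "'w measure" +
  fixes T :: "nat \<Rightarrow> 'w \<Rightarrow> complex mat" and r :: nat and d :: "nat \<Rightarrow> nat"
    and S :: "nat set" and c :: "nat \<Rightarrow> complex"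
  assumes finite_S: "finite S" and S_subset: "S \<subseteq> {..<d 0}"
    and indep: "indep_vars (\<lambda>j. mat_borel (d j) (d (j - 1))) T {1..r}"
    and bdd_T: "\<And>j i k. j \<in> {1..r} \<Longrightarrow> i < d j \<Longrightarrow> k < d (j - 1) \<Longrightarrow>
      bdd_measurable M (\<lambda>\<omega>. T j \<omega> $$ (i, k))"
    and minor_T: "\<And>j l l' p. j \<in> {1..r} \<Longrightarrow> l ` S \<subseteq> {..<d j} \<Longrightarrow> l' ` S \<subseteq> {..<d j} \<Longrightarrow>
      p ` S \<subseteq> {..<d (j - 1)} \<Longrightarrow>
      (\<integral>\<omega>. minor_term S l l' p (T j \<omega>) \<partial>M) =
        of_bool (inj_on p S) * c j * det_on S (\<lambda>i j. of_bool (l' i = l j))"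
begin

abbreviation Y :: "nat \<Rightarrow> 'w \<Rightarrow> complex mat" where
  "Y m \<omega> \<equiv> mat_product (d 0) (\<lambda>j. T j \<omega>) m"

lemma T_carrier: "j \<in> {1..r} \<Longrightarrow> \<omega> \<in> space M \<Longrightarrow> T j \<omega> \<in> carrier_mat (d j) (d (j - 1))"
  using indep measurable_space[of "T j" M "mat_borel (d j) (d (j - 1))" \<omega>]
  by (auto simp: indep_vars_def)

lemma Y_carrier: "m \<le> r \<Longrightarrow> \<omega> \<in> space M \<Longrightarrow> Y m \<omega> \<in> carrier_mat (d m) (d 0)"
  by (rule mat_product_carrier, rule T_carrier) auto

lemma bdd_Y: "m \<le> r \<Longrightarrow> i < d m \<Longrightarrow> k < d 0 \<Longrightarrow> bdd_measurable M (\<lambda>\<omega>. Y m \<omega> $$ (i, k))"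
proof (induction m arbitrary: i k)
  case 0
  then show ?case by (simp add: bdd_measurable_const)
next
  case (Suc m)
  have "bdd_measurable M (\<lambda>\<omega>. \<Sum>x<d m. T (Suc m) \<omega> $$ (i, x) * Y m \<omega> $$ (x, k))"
    using Suc.prems by (intro bdd_measurable_intros bdd_T Suc.IH) auto
  moreover have "Y (Suc m) \<omega> $$ (i, k) = (\<Sum>x<d m. T (Suc m) \<omega> $$ (i, x) * Y m \<omega> $$ (x, k))"
    if "\<omega> \<in> space M" for \<omega>
    using T_carrier[of "Suc m" \<omega>] Y_carrier[of m \<omega>] Suc.prems that
    by (simp add: scalar_prod_def atLeast0LessThan)
  ultimately show ?case
    by (subst bdd_measurable_cong) auto
qed

lemma bdd_minor_Y:
  "m \<le> r \<Longrightarrow> l ` S \<subseteq> {..<d m} \<Longrightarrow> l' ` S \<subseteq> {..<d m} \<Longrightarrow>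
    bdd_measurable M (\<lambda>\<omega>. minor_term S l l' (\<lambda>i. i) (Y m \<omega>))"
  unfolding minor_term_def using S_subset by (intro bdd_measurable_intros bdd_Y) auto

text \<open>
  The factors \<open>h j (T j)\<close> of the later matrices are carried along so that the independence of
  \<open>T 1, \<dots>, T r\<close> is used only once, in the base case.
\<close>

lemma expectation_minor_Y_times:
  assumes "m \<le> r"
    and "\<And>j. j \<in> {Suc m..r} \<Longrightarrow> h j \<in> borel_measurable (mat_borel (d j) (d (j - 1)))"
    and "\<And>j. j \<in> {Suc m..r} \<Longrightarrow> bdd_measurable M (\<lambda>\<omega>. h j (T j \<omega>))"
    and "l ` S \<subseteq> {..<d m}" "l' ` S \<subseteq> {..<d m}"
  shows "(\<integral>\<omega>. minor_term S l l' (\<lambda>i. i) (Y m \<omega>) * (\<Prod>j=Suc m..r. h j (T j \<omega>)) \<partial>M) =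
    minor_weight S d c m l * det_on S (\<lambda>i j. of_bool (l' i = l j)) * (\<Prod>j=Suc m..r. \<integral>\<omega>. h j (T j \<omega>) \<partial>M)"
  using assms
proof (induction m arbitrary: h l l')
  case 0
  have "indep_vars (\<lambda>_. borel) (\<lambda>j \<omega>. h j (T j \<omega>)) {1..r}"
    by (rule indep_vars_compose2[OF indep]) (use 0 in auto)
  then have "(\<integral>\<omega>. (\<Prod>j=1..r. h j (T j \<omega>)) \<partial>M) = (\<Prod>j=1..r. \<integral>\<omega>. h j (T j \<omega>) \<partial>M)"
    using 0 by (intro indep_vars_lebesgue_integral bdd_measurable_integrable) auto
  then show ?case
    using 0 finite_S S_subset by (simp add: minor_term_one)
next
  case (Suc m)
  let ?I = "S \<rightarrow>\<^sub>E {..<d m}"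
  let ?H = "\<lambda>p q A. (\<Prod>i\<in>S. cnj (A $$ (l i, p i))) * (\<Prod>i\<in>S. A $$ (l' i, q i))"
  \<comment> \<open>The entries split off from \<open>T (Suc m)\<close> become the function carried
    at index \<open>Suc m\<close>, so the induction hypothesis for \<open>m\<close> applies.\<close>
  let ?h = "\<lambda>p q. h(Suc m := ?H p q)"
  let ?rest = "\<Prod>j=Suc (Suc m)..r. \<integral>\<omega>. h j (T j \<omega>) \<partial>M"
  have m: "Suc m \<in> {1..r}" using Suc.prems(1) by simp
  have prod_T: "(\<Prod>j=Suc m..r. ?h p q j (T j \<omega>)) =
      ?H p q (T (Suc m) \<omega>) * (\<Prod>j=Suc (Suc m)..r. h j (T j \<omega>))" for p q \<omega>
    using Suc.prems(1) by (simp add: prod.atLeast_Suc_atMost[of "Suc m" r])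
  have prod_E: "(\<Prod>j=Suc m..r. \<integral>\<omega>. ?h p q j (T j \<omega>) \<partial>M) = (\<integral>\<omega>. ?H p q (T (Suc m) \<omega>) \<partial>M) * ?rest" for p q
    using Suc.prems(1) by (simp add: prod.atLeast_Suc_atMost[of "Suc m" r])
  have meas: "?h p q j \<in> borel_measurable (mat_borel (d j) (d (j - 1)))"
    if "p \<in> ?I" "q \<in> ?I" "j \<in> {Suc m..r}" for p q j
  proof (cases "j = Suc m")
    case True
    have "(\<lambda>A. cnj (A $$ (l i, p i))) \<in> borel_measurable (mat_borel (d (Suc m)) (d m))" if "i \<in> S" for i
      using that \<open>p \<in> ?I\<close> Suc.prems(4)
      by (intro borel_measurable_continuous_on[where f = cnj] continuous_intros measurable_mat_entry) auto
    then show ?thesis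
      using True that Suc.prems(5)
      by (auto intro!: borel_measurable_times borel_measurable_prod measurable_mat_entry)
  qed (use that Suc.prems(2) in auto)
  have bdd_H: "bdd_measurable M (\<lambda>\<omega>. ?H p q (T (Suc m) \<omega>))" if "p \<in> ?I" "q \<in> ?I" for p q
    using that Suc.prems(4,5) m by (intro bdd_measurable_intros bdd_T) auto
  then have bdd: "bdd_measurable M (\<lambda>\<omega>. ?h p q j (T j \<omega>))" if "p \<in> ?I" "q \<in> ?I" "j \<in> {Suc m..r}" for p q j
    using that Suc.prems(3)[of j] by (cases "j = Suc m") auto
  have "(\<integral>\<omega>. minor_term S l l' (\<lambda>i. i) (Y (Suc m) \<omega>) * (\<Prod>j=Suc (Suc m)..r. h j (T j \<omega>)) \<partial>M) =
      (\<integral>\<omega>. (\<Sum>p\<in>?I. \<Sum>q\<in>?I. minor_term S p q (\<lambda>i. i) (Y m \<omega>) * (\<Prod>j=Suc m..r. ?h p q j (T j \<omega>))) \<partial>M)"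
  proof (intro Bochner_Integration.integral_cong refl)
    fix \<omega> assume "\<omega> \<in> space M"
    then have "T (Suc m) \<omega> \<in> carrier_mat (d (Suc m)) (d m)" "Y m \<omega> \<in> carrier_mat (d m) (d 0)"
      using T_carrier[OF m] Y_carrier[of m] Suc.prems(1) by auto
    then have "minor_term S l l' (\<lambda>i. i) (Y (Suc m) \<omega>) =
        (\<Sum>p\<in>?I. \<Sum>q\<in>?I. minor_term S p q (\<lambda>i. i) (Y m \<omega>) * ?H p q (T (Suc m) \<omega>))"
      using finite_S S_subset Suc.prems(4,5) unfolding mat_product.simps
      by (intro minor_term_mult) auto
    then show "minor_term S l l' (\<lambda>i. i) (Y (Suc m) \<omega>) * (\<Prod>j=Suc (Suc m)..r. h j (T j \<omega>)) =
        (\<Sum>p\<in>?I. \<Sum>q\<in>?I. minor_term S p q (\<lambda>i. i) (Y m \<omega>) * (\<Prod>j=Suc m..r. ?h p q j (T j \<omega>)))"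
      by (simp only: prod_T sum_distrib_right mult.assoc)
  qed
  also have "\<dots> = (\<Sum>p\<in>?I. \<Sum>q\<in>?I.
      \<integral>\<omega>. minor_term S p q (\<lambda>i. i) (Y m \<omega>) * (\<Prod>j=Suc m..r. ?h p q j (T j \<omega>)) \<partial>M)"
    (is "_ = (\<Sum>p\<in>?I. \<Sum>q\<in>?I. integral\<^sup>L M (?f p q))")
  proof -
    have "bdd_measurable M (?f p q)" if "p \<in> ?I" "q \<in> ?I" for p q
      using that Suc.prems(1) by (intro bdd_measurable_mult bdd_measurable_prod bdd bdd_minor_Y) auto
    then have int: "integrable M (?f p q)" if "p \<in> ?I" "q \<in> ?I" for p q
      using that by (blast intro: bdd_measurable_integrable)
    show ?thesis
      by (subst Bochner_Integration.integral_sum, (intro Bochner_Integration.integrable_sum int; assumption),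
          intro sum.cong refl Bochner_Integration.integral_sum int)
  qed
  also have "\<dots> = (\<Sum>p\<in>?I. \<Sum>q\<in>?I. minor_weight S d c m p * ?rest *
      (\<integral>\<omega>. det_on S (\<lambda>i j. of_bool (q i = p j)) * ?H p q (T (Suc m) \<omega>) \<partial>M))"
  proof (intro sum.cong refl)
    fix p q assume pq: "p \<in> ?I" "q \<in> ?I"
    have "(\<integral>\<omega>. minor_term S p q (\<lambda>i. i) (Y m \<omega>) * (\<Prod>j=Suc m..r. ?h p q j (T j \<omega>)) \<partial>M) =
      minor_weight S d c m p * det_on S (\<lambda>i j. of_bool (q i = p j)) *
        (\<Prod>j=Suc m..r. \<integral>\<omega>. ?h p q j (T j \<omega>) \<partial>M)"
    proof (rule Suc.IH)
      show "?h p q j \<in> borel_measurable (mat_borel (d j) (d (j - 1)))" if "j \<in> {Suc m..r}" for j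
        using pq that by (rule meas)
      show "bdd_measurable M (\<lambda>\<omega>. ?h p q j (T j \<omega>))" if "j \<in> {Suc m..r}" for j
        using pq that by (rule bdd)
    qed (use pq Suc.prems(1) in auto)
    also have "(\<Prod>j=Suc m..r. \<integral>\<omega>. ?h p q j (T j \<omega>) \<partial>M) = (\<integral>\<omega>. ?H p q (T (Suc m) \<omega>) \<partial>M) * ?rest"
      by (rule prod_E)
    finally show "(\<integral>\<omega>. minor_term S p q (\<lambda>i. i) (Y m \<omega>) * (\<Prod>j=Suc m..r. ?h p q j (T j \<omega>)) \<partial>M) =
      minor_weight S d c m p * ?rest * (\<integral>\<omega>. det_on S (\<lambda>i j. of_bool (q i = p j)) * ?H p q (T (Suc m) \<omega>) \<partial>M)"
      by (simp add: mult_ac)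
  qed
  also have "\<dots> = (\<Sum>p\<in>?I. minor_weight S d c m p * ?rest *
      (\<Sum>q\<in>?I. \<integral>\<omega>. det_on S (\<lambda>i j. of_bool (q i = p j)) * ?H p q (T (Suc m) \<omega>) \<partial>M))"
    by (simp only: sum_distrib_left)
  \<comment> \<open>For fixed \<open>p\<close>, the sum over \<open>q\<close> of the 0/1 determinant
    against the split-off entries is a \<open>minor_term\<close> of \<open>T (Suc m)\<close> with
    column map \<open>p\<close>.\<close>
  also have "\<dots> = (\<Sum>p\<in>?I. minor_weight S d c m p * ?rest *
      (\<integral>\<omega>. minor_term S l l' p (T (Suc m) \<omega>) \<partial>M))"
  proof (intro sum.cong refl arg_cong2[where f = "(*)"])
    fix p assume p: "p \<in> ?I"
    have "(\<Sum>q\<in>?I. \<integral>\<omega>. det_on S (\<lambda>i j. of_bool (q i = p j)) * ?H p q (T (Suc m) \<omega>) \<partial>M) =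
        (\<integral>\<omega>. (\<Sum>q\<in>?I. det_on S (\<lambda>i j. of_bool (q i = p j)) * ?H p q (T (Suc m) \<omega>)) \<partial>M)"
      using p by (intro Bochner_Integration.integral_sum[symmetric] bdd_measurable_integrable
          bdd_measurable_mult[OF bdd_measurable_const] bdd_H) auto
    also have "\<dots> = (\<integral>\<omega>. minor_term S l l' p (T (Suc m) \<omega>) \<partial>M)"
      using p by (intro Bochner_Integration.integral_cong refl minor_term_conv_sum[symmetric] finite_S) auto
    finally show "(\<Sum>q\<in>?I. \<integral>\<omega>. det_on S (\<lambda>i j. of_bool (q i = p j)) * ?H p q (T (Suc m) \<omega>) \<partial>M) =
        (\<integral>\<omega>. minor_term S l l' p (T (Suc m) \<omega>) \<partial>M)" .
  qed
  also have "\<dots> = (\<Sum>p\<in>?I. minor_weight S d c m p * ?rest *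
      (of_bool (inj_on p S) * c (Suc m) * det_on S (\<lambda>i j. of_bool (l' i = l j))))"
  proof (intro sum.cong refl arg_cong2[where f = "(*)"] minor_T m)
    fix p assume "p \<in> ?I"
    then show "p ` S \<subseteq> {..<d (Suc m - 1)}" by auto
  qed (use Suc.prems(4,5) in auto)
  also have "\<dots> = minor_weight S d c (Suc m) l * det_on S (\<lambda>i j. of_bool (l' i = l j)) * ?rest"
    by (simp add: sum_distrib_left sum_distrib_right mult_ac)
  finally show ?case .
qed

text \<open>The Gram minor is the sum of the diagonal terms \<open>l' = l\<close>, for which the 0/1
  determinant reduces to the indicator that \<open>l\<close> is injective.\<close>

lemma
  shows bdd_gram_minor: "bdd_measurable M (\<lambda>\<omega>. det_on S (\<lambda>i j. (mat_adjoint (Y r \<omega>) * Y r \<omega>) $$ (i, j)))"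
    and expectation_gram_minor: "(\<integral>\<omega>. det_on S (\<lambda>i j. (mat_adjoint (Y r \<omega>) * Y r \<omega>) $$ (i, j)) \<partial>M) =
      (\<Prod>j=1..r. c j * (\<Prod>i<card S. of_nat (d j - i)))"
proof -
  let ?I = "S \<rightarrow>\<^sub>E {..<d r}"
  have eq: "det_on S (\<lambda>i j. (mat_adjoint (Y r \<omega>) * Y r \<omega>) $$ (i, j)) =
      (\<Sum>l\<in>?I. minor_term S l l (\<lambda>i. i) (Y r \<omega>))" if "\<omega> \<in> space M" for \<omega>
  proof -
    have "det_on S (\<lambda>i j. (mat_adjoint (Y r \<omega>) * Y r \<omega>) $$ (i, j)) =
        det_on S (\<lambda>i j. \<Sum>x<d r. cnj (Y r \<omega> $$ (x, i)) * Y r \<omega> $$ (x, j))"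
      by (rule det_on_cong, rule adjoint_mult_index[OF Y_carrier]) (use that S_subset in auto)
    then show ?thesis
      unfolding minor_term_def using finite_S by (simp add: det_on_sum_mult)
  qed
  have bdd: "bdd_measurable M (\<lambda>\<omega>. minor_term S l l (\<lambda>i. i) (Y r \<omega>))" if "l \<in> ?I" for l
    using that by (intro bdd_minor_Y) auto
  then show "bdd_measurable M (\<lambda>\<omega>. det_on S (\<lambda>i j. (mat_adjoint (Y r \<omega>) * Y r \<omega>) $$ (i, j)))"
    by (subst bdd_measurable_cong[OF eq]) (auto intro!: bdd_measurable_sum)
  have "(\<integral>\<omega>. det_on S (\<lambda>i j. (mat_adjoint (Y r \<omega>) * Y r \<omega>) $$ (i, j)) \<partial>M) =
      (\<integral>\<omega>. (\<Sum>l\<in>?I. minor_term S l l (\<lambda>i. i) (Y r \<omega>)) \<partial>M)"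
    by (rule Bochner_Integration.integral_cong[OF refl eq])
  also have "\<dots> = (\<Sum>l\<in>?I. \<integral>\<omega>. minor_term S l l (\<lambda>i. i) (Y r \<omega>) \<partial>M)"
    using bdd by (intro Bochner_Integration.integral_sum bdd_measurable_integrable)
  also have "\<dots> = (\<Sum>l\<in>?I. of_bool (inj_on l S) * minor_weight S d c r l)"
  proof (intro sum.cong refl)
    fix l assume "l \<in> ?I"
    \<comment> \<open>With \<open>m = r\<close> no later factor remains, so the carried functions
      are chosen to be constant 1 and their product is empty.\<close>
    then show "(\<integral>\<omega>. minor_term S l l (\<lambda>i. i) (Y r \<omega>) \<partial>M) = of_bool (inj_on l S) * minor_weight S d c r l"
      using expectation_minor_Y_times[of r "\<lambda>_ _. 1" l l]
      by (simp add: det_on_of_bool[OF finite_S] image_subset_iff PiE_iff)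
  qed
  also have "\<dots> = (\<Prod>j=1..r. c j * (\<Prod>i<card S. of_nat (d j - i)))"
    by (rule sum_minor_weight) (use finite_S S_subset in auto)
  finally show "(\<integral>\<omega>. det_on S (\<lambda>i j. (mat_adjoint (Y r \<omega>) * Y r \<omega>) $$ (i, j)) \<partial>M) =
      (\<Prod>j=1..r. c j * (\<Prod>i<card S. of_nat (d j - i)))" .
qed

end

section \<open>From squared singular values to principal minors\<close>

lemma eigenvalue_adjoint_mult_real:
  fixes A :: "complex mat"
  assumes A: "A \<in> carrier_mat m n" and ev: "eigenvalue (mat_adjoint A * A) z"
  shows "Im z = 0"
proof -
  let ?Z = "mat_adjoint A * A"
  obtain v where v: "v \<in> carrier_vec n" "v \<noteq> 0\<^sub>v n" "?Z *\<^sub>v v = z \<cdot>\<^sub>v v"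
    using ev A by (auto simp: eigenvalue_def eigenvector_def)
  obtain i0 where i0: "i0 < n" "v $ i0 \<noteq> 0"
    using v(1,2) by (auto simp: vec_eq_iff)
  \<comment> \<open>\<open>p\<close> and \<open>q\<close> are the squared norms of \<open>v\<close>
    and of \<open>A\<close> applied to \<open>v\<close>. Pairing the eigenvalue equation with
    \<open>v\<close> gives \<open>z * p = q\<close> with \<open>p > 0\<close>, so \<open>z\<close>
    is real.\<close>
  define p q where "p = (\<Sum>i<n. (norm (v $ i))\<^sup>2)" and "q = (\<Sum>x<m. (norm (\<Sum>j<n. A $$ (x, j) * v $ j))\<^sup>2)"
  have sq: "cnj w * w = complex_of_real ((norm w)\<^sup>2)" for w
    using complex_norm_square[of w] by (simp add: mult.commute)
  have "z * complex_of_real p = (\<Sum>i<n. cnj (v $ i) * (z * v $ i))"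
    by (simp only: p_def of_real_sum sq[symmetric] sum_distrib_left mult_ac)
  also have "\<dots> = (\<Sum>i<n. cnj (v $ i) * (\<Sum>j<n. (\<Sum>x<m. cnj (A $$ (x, i)) * A $$ (x, j)) * v $ j))"
  proof (intro sum.cong refl)
    fix i assume "i \<in> {..<n}"
    then have i: "i < n" by simp
    have "z * v $ i = (?Z *\<^sub>v v) $ i"
      using v i by simp
    also have "\<dots> = (\<Sum>j<n. ?Z $$ (i, j) * v $ j)"
      using v(1) i A by (simp add: scalar_prod_def atLeast0LessThan del: index_mult_mat(1))
    also have "\<dots> = (\<Sum>j<n. (\<Sum>x<m. cnj (A $$ (x, i)) * A $$ (x, j)) * v $ j)"
      by (intro sum.cong refl) (use adjoint_mult_index[OF A i] in auto)
    finally show "cnj (v $ i) * (z * v $ i) =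
        cnj (v $ i) * (\<Sum>j<n. (\<Sum>x<m. cnj (A $$ (x, i)) * A $$ (x, j)) * v $ j)"
      by simp
  qed
  also have "\<dots> = (\<Sum>i<n. \<Sum>j<n. \<Sum>x<m. (cnj (A $$ (x, i)) * cnj (v $ i)) * (A $$ (x, j) * v $ j))"
    by (simp add: sum_distrib_left sum_distrib_right mult_ac)
  also have "\<dots> = (\<Sum>i<n. \<Sum>x<m. \<Sum>j<n. (cnj (A $$ (x, i)) * cnj (v $ i)) * (A $$ (x, j) * v $ j))"
    by (rule sum.cong[OF refl], rule sum.swap)
  also have "\<dots> = (\<Sum>x<m. \<Sum>i<n. \<Sum>j<n. (cnj (A $$ (x, i)) * cnj (v $ i)) * (A $$ (x, j) * v $ j))"
    by (rule sum.swap)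
  also have "\<dots> = (\<Sum>x<m. cnj (\<Sum>j<n. A $$ (x, j) * v $ j) * (\<Sum>j<n. A $$ (x, j) * v $ j))"
    by (simp add: sum_product)
  also have "\<dots> = complex_of_real q"
    by (simp only: q_def of_real_sum sq)
  finally have eq: "z * complex_of_real p = complex_of_real q" .
  have "0 < (norm (v $ i0))\<^sup>2"
    using i0 by simp
  also have "\<dots> \<le> p"
    unfolding p_def using i0 by (intro member_le_sum) auto
  finally show ?thesis
    using arg_cong[OF eq, of Im] by simp
qed

text \<open>Over the complex numbers the monic characteristic polynomial is the product of its
  linear factors. Taking real parts of its roots changes nothing because all of them are
  real.\<close>

lemma prod_squared_singular_values:
  assumes A: "A \<in> carrier_mat m n"
  shows "complex_of_real (\<Prod>y\<in>#squared_singular_values A. x - y) =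
    det (complex_of_real x \<cdot>\<^sub>m 1\<^sub>m n - mat_adjoint A * A)"
proof -
  let ?Z = "mat_adjoint A * A"
  have Z: "?Z \<in> carrier_mat n n"
    using A by auto
  let ?p = "char_poly ?Z"
  have monic: "lead_coeff ?p = 1"
    using degree_monic_char_poly[OF Z] by simp
  then have "?p \<noteq> 0" by auto
  have real: "complex_of_real (Re z) = z" if "z \<in># proots ?p" for z
  proof -
    have "eigenvalue ?Z z"
      using that \<open>?p \<noteq> 0\<close> by (simp add: eigenvalue_root_char_poly[OF Z])
    from eigenvalue_adjoint_mult_real[OF A this] show ?thesis
      by (simp add: complex_eq_iff)
  qed
  have of_real_prod: "complex_of_real (\<Prod>y\<in>#B. x - Re y) = (\<Prod>y\<in>#B. complex_of_real (x - Re y))" for B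
    by (induction B) auto
  have "complex_of_real (\<Prod>y\<in>#squared_singular_values A. x - y) =
      (\<Prod>z\<in>#proots ?p. complex_of_real (x - Re z))"
    by (simp only: of_real_prod[symmetric] squared_singular_values_def image_mset.compositionality comp_def)
  also have "\<dots> = (\<Prod>z\<in>#proots ?p. poly [:-z, 1:] (complex_of_real x))"
    by (intro arg_cong[of _ _ prod_mset] image_mset_cong) (simp add: real)
  also have "\<dots> = poly (\<Prod>z\<in>#proots ?p. [:-z, 1:]) (complex_of_real x)"
    by (simp add: poly_prod_mset image_mset.compositionality comp_def)
  also have "\<dots> = poly ?p (complex_of_real x)"
    using complex_poly_decompose_multiset[of ?p] monic by simp
  also have "\<dots> = det (- char_matrix ?Z (complex_of_real x))"
    by (rule char_poly_matrix[OF Z])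
  also have "- char_matrix ?Z (complex_of_real x) = complex_of_real x \<cdot>\<^sub>m 1\<^sub>m n - ?Z"
    by (rule eq_matI) (use A in \<open>auto simp: char_matrix_def\<close>)
  finally show ?thesis .
qed

lemma sum_Pow_card:
  fixes g :: "nat \<Rightarrow> 'a :: semiring_1"
  assumes "finite A"
  shows "(\<Sum>S\<in>Pow A. g (card S)) = (\<Sum>k\<le>card A. of_nat (card A choose k) * g k)"
proof -
  have "(\<Sum>S\<in>Pow A. g (card S)) = (\<Sum>k\<le>card A. \<Sum>S | S \<in> Pow A \<and> card S = k. g (card S))"
    using assms by (intro sum.group[symmetric]) (auto intro: card_mono)
  also have "\<dots> = (\<Sum>k\<le>card A. of_nat (card A choose k) * g k)"
    using n_subsets[OF assms] by (intro sum.cong refl) simp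
  finally show ?thesis .
qed

section \<open>Truncations of Haar unitary matrices\<close>

context prob_space
begin

lemma bdd_measurable_haar_entry:
  assumes "haar_distributed M N U" "i < N" "j < N"
  shows "bdd_measurable M (\<lambda>\<omega>. U \<omega> $$ (i, j))"
proof -
  have U: "U \<in> M \<rightarrow>\<^sub>M unitary_borel N"
    using assms(1) by (simp add: haar_distributed_def)
  have "(\<lambda>\<omega>. U \<omega> $$ (i, j)) \<in> borel_measurable M"
    using measurable_compose[OF U bdd_measurableD[OF bdd_measurable_unitary_entry[OF assms(2,3)]]] .
  moreover have "\<forall>\<omega>\<in>space M. norm (U \<omega> $$ (i, j)) \<le> 1"
    using measurable_space[OF U] assms(2,3) by (auto intro: unitary_group_entry_le_1)
  ultimately show ?thesis
    by (auto simp: bdd_measurable_def)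
qed

text \<open>Minors of an upper left corner are minors of the whole matrix, so the size of the corner
  does not enter the value. Non-injective column maps give 0 by equal columns.\<close>

lemma expectation_truncation_minor_term:
  assumes U: "haar_distributed M N U" and S: "finite S"
    and T: "\<And>\<omega>. \<omega> \<in> space M \<Longrightarrow> T \<omega> = truncation m k (U \<omega>)" and "m \<le> N" "k \<le> N"
    and l: "l ` S \<subseteq> {..<m}" and l': "l' ` S \<subseteq> {..<m}" and p: "p ` S \<subseteq> {..<k}"
  shows "(\<integral>\<omega>. minor_term S l l' p (T \<omega>) \<partial>M) =
    of_bool (inj_on p S) * (1 / (\<Prod>i<card S. of_nat (N - i))) * det_on S (\<lambda>i j. of_bool (l' i = l j))"
proof (cases "inj_on p S")
  case False
  then obtain a b where "a \<in> S" "b \<in> S" "a \<noteq> b" "p a = p b"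
    by (auto simp: inj_on_def)
  then have "minor_term S l l' p A = 0" for A
    by (simp add: minor_term_def det_on_equal_cols[of S a b] S)
  then show ?thesis
    using False by simp
next
  case True
  have range: "l ` S \<subseteq> {..<N}" "l' ` S \<subseteq> {..<N}" "p ` S \<subseteq> {..<N}"
    using assms(4,5) l l' p by fastforce+
  have meas: "U \<in> M \<rightarrow>\<^sub>M unitary_borel N"
    using U by (simp add: haar_distributed_def)
  have "minor_term S l l' p (T \<omega>) = minor_term S l l' p (U \<omega>)" if "\<omega> \<in> space M" for \<omega>
  proof -
    have entry: "T \<omega> $$ (i, j) = U \<omega> $$ (i, j)" if "i < m" "j < k" for i j
      using that by (simp add: T[OF \<open>\<omega> \<in> space M\<close>] truncation_def)
    show ?thesis
      unfolding minor_term_def using l l' p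
      by (intro arg_cong2[where f = "(*)"] prod.cong det_on_cong refl arg_cong[where f = cnj] entry)
         (simp_all add: image_subset_iff)
  qed
  then have "(\<integral>\<omega>. minor_term S l l' p (T \<omega>) \<partial>M) = (\<integral>\<omega>. minor_term S l l' p (U \<omega>) \<partial>M)"
    by (intro Bochner_Integration.integral_cong refl)
  also have "\<dots> = (\<integral>V. minor_term S l l' p V \<partial>distr M (unitary_borel N) U)"
  proof (rule integral_distr[symmetric, OF meas])
    have "bdd_measurable (unitary_borel N) (minor_term S l l' p)"
      unfolding minor_term_def using range
      by (intro bdd_measurable_intros) auto
    then show "minor_term S l l' p \<in> borel_measurable (unitary_borel N)"
      by (rule bdd_measurableD)
  qed
  also have "\<dots> = det_on S (\<lambda>i j. of_bool (l' i = l j)) / (\<Prod>i<card S. of_nat (N - i))"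
    using U S range True unfolding haar_distributed_def
    by (intro haar_minor_term_expectation) auto
  finally show ?thesis
    using True by simp
qed

text \<open>The expected principal minors depend on \<open>S\<close> only through its cardinality,
  so the expansion over subsets collapses to a sum over \<open>k\<close> with weight
  \<open>d 0 choose k\<close>. The computation is complex and returns to the reals by injectivity of
  the embedding.\<close>

lemma
  fixes T U :: "nat \<Rightarrow> 'a \<Rightarrow> complex mat"
  assumes N: "\<And>j. j \<in> {1..r} \<Longrightarrow> d j \<le> N j \<and> d (j - 1) \<le> N j"
    and U: "\<And>j. j \<in> {1..r} \<Longrightarrow> haar_distributed M (N j) (U j)"
    and T: "\<And>j \<omega>. j \<in> {1..r} \<Longrightarrow> \<omega> \<in> space M \<Longrightarrow> T j \<omega> = truncation (d j) (d (j - 1)) (U j \<omega>)"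
    and indep: "indep_vars (\<lambda>j. mat_borel (d j) (d (j - 1))) T {1..r}"
  shows integrable_char_poly_truncations:
      "integrable M (\<lambda>\<omega>. \<Prod>y\<in>#squared_singular_values (mat_product (d 0) (\<lambda>j. T j \<omega>) r). x - y)"
      (is "integrable M ?f")
    and expectation_char_poly_truncations:
      "expectation (\<lambda>\<omega>. \<Prod>y\<in>#squared_singular_values (mat_product (d 0) (\<lambda>j. T j \<omega>) r). x - y) =
        (\<Sum>k\<le>d 0. (-1) ^ k * of_nat (d 0 choose k) * x ^ (d 0 - k) *
          (\<Prod>j=1..r. (\<Prod>i<k. of_nat (d j - i)) / (\<Prod>i<k. of_nat (N j - i))))"
      (is "_ = ?rhs")
proof -
  let ?n = "d 0"
  let ?Y = "\<lambda>\<omega>. mat_product ?n (\<lambda>j. T j \<omega>) r"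
  let ?c = "\<lambda>S j. 1 / (\<Prod>i<card S. of_nat (N j - i)) :: complex"
  let ?G = "\<lambda>S \<omega>. det_on S (\<lambda>i j. (mat_adjoint (?Y \<omega>) * ?Y \<omega>) $$ (i, j))"
  let ?e = "\<lambda>S. (-1) ^ card S * complex_of_real x ^ (?n - card S)"
  have minors: "independent_minors M T r d S (?c S)" if "S \<in> Pow {0..<?n}" for S
  proof unfold_locales
    show S: "finite S" "S \<subseteq> {..<?n}"
      using that finite_subset by auto
    show "indep_vars (\<lambda>j. mat_borel (d j) (d (j - 1))) T {1..r}"
      by (rule indep)
    fix j assume j: "j \<in> {1..r}"
    show "bdd_measurable M (\<lambda>\<omega>. T j \<omega> $$ (i, k))" if "i < d j" "k < d (j - 1)" for i k
    proof -
      have "bdd_measurable M (\<lambda>\<omega>. U j \<omega> $$ (i, k))"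
        using N[OF j] that by (intro bdd_measurable_haar_entry[OF U[OF j]]) auto
      moreover have "T j \<omega> $$ (i, k) = U j \<omega> $$ (i, k)" if "\<omega> \<in> space M" for \<omega>
        using \<open>i < d j\<close> \<open>k < d (j - 1)\<close> by (simp add: T[OF j that] truncation_def)
      ultimately show ?thesis
        unfolding bdd_measurable_def by (auto cong: measurable_cong)
    qed
    show "(\<integral>\<omega>. minor_term S l l' p (T j \<omega>) \<partial>M) =
        of_bool (inj_on p S) * ?c S j * det_on S (\<lambda>i j. of_bool (l' i = l j))"
      if "l ` S \<subseteq> {..<d j}" "l' ` S \<subseteq> {..<d j}" "p ` S \<subseteq> {..<d (j - 1)}" for l l' p
      by (rule expectation_truncation_minor_term[OF U[OF j] S(1) T[OF j]]) (use N[OF j] that in auto)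
  qed
  have int: "integrable M (?G S)" if "S \<in> Pow {0..<?n}" for S
    using independent_minors.bdd_gram_minor[OF minors[OF that]] by (rule bdd_measurable_integrable)
  have eq: "complex_of_real (?f \<omega>) = (\<Sum>S\<in>Pow {0..<?n}. ?e S * ?G S \<omega>)" if \<omega>: "\<omega> \<in> space M" for \<omega>
  proof -
    have Y: "?Y \<omega> \<in> carrier_mat (d r) ?n"
      using T \<omega> by (intro mat_product_carrier) (simp add: truncation_def)
    then have Z: "mat_adjoint (?Y \<omega>) * ?Y \<omega> \<in> carrier_mat ?n ?n"
      by (intro mult_carrier_mat[of _ ?n "d r"] carrier_matI) auto
    show ?thesis
      by (rule trans[OF prod_squared_singular_values[OF Y] det_char_expansion[OF Z]])
  qed
  have "integrable M (\<lambda>\<omega>. \<Sum>S\<in>Pow {0..<?n}. ?e S * ?G S \<omega>)"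
    using int by (intro Bochner_Integration.integrable_sum integrable_mult_right)
  then have "integrable M (\<lambda>\<omega>. complex_of_real (?f \<omega>))"
    by (rule Bochner_Integration.integrable_cong[THEN iffD1, rotated -1]) (simp_all only: eq)
  then show int_f: "integrable M ?f"
    by (simp only: complex_of_real_integrable_eq)
  have "complex_of_real (expectation ?f) = (\<integral>\<omega>. complex_of_real (?f \<omega>) \<partial>M)"
    by (rule integral_complex_of_real[symmetric])
  also have "\<dots> = (\<integral>\<omega>. (\<Sum>S\<in>Pow {0..<?n}. ?e S * ?G S \<omega>) \<partial>M)"
    by (rule Bochner_Integration.integral_cong[OF refl eq])
  also have "\<dots> = (\<Sum>S\<in>Pow {0..<?n}. ?e S * (\<integral>\<omega>. ?G S \<omega> \<partial>M))"
    using int by (subst Bochner_Integration.integral_sum) (auto intro!: integrable_mult_right)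
  also have "\<dots> = (\<Sum>S\<in>Pow {0..<?n}. ?e S * (\<Prod>j=1..r. ?c S j * (\<Prod>i<card S. of_nat (d j - i))))"
    by (intro sum.cong refl) (simp only: independent_minors.expectation_gram_minor[OF minors])
  also have "\<dots> = (\<Sum>k\<le>?n. of_nat (?n choose k) * ((-1) ^ k * complex_of_real x ^ (?n - k) *
      (\<Prod>j=1..r. 1 / (\<Prod>i<k. of_nat (N j - i)) * (\<Prod>i<k. of_nat (d j - i)))))"
    using sum_Pow_card[of "{0..<?n}" "\<lambda>k. (-1) ^ k * complex_of_real x ^ (?n - k) *
      (\<Prod>j=1..r. 1 / (\<Prod>i<k. of_nat (N j - i)) * (\<Prod>i<k. of_nat (d j - i)))"] by simp
  also have "\<dots> = complex_of_real ?rhs"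
    by (simp add: mult_ac)
  finally show "expectation ?f = ?rhs"
    by (simp only: of_real_eq_iff)
qed

end

subsection \<open>The hypergeometric polynomial\<close>

text \<open>An \<open>n\<close>-th finite difference annihilates polynomials of degree below
  \<open>n\<close>. Pascal's rule writes it as an \<open>(n - 1)\<close>-st difference of
  \<open>q(x) - q(x + 1)\<close>, which has lower degree. The disjunct \<open>q = 0\<close> covers
  the zero polynomial, whose \<open>degree\<close> is 0 by convention.\<close>

lemma alternating_binomial_sum_poly_eq_0:
  fixes q :: "real poly"
  assumes "q = 0 \<or> degree q < n"
  shows "(\<Sum>l\<le>n. (-1) ^ l * of_nat (n choose l) * poly q (of_nat l)) = 0"
  using assms
proof (induction n arbitrary: q)
  case 0
  then show ?case by auto
next
  case (Suc n)
  define p where "p = q - pcompose q [:1, 1:]"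
  have poly_p: "poly p (of_nat l) = poly q (of_nat l) - poly q (of_nat (Suc l))" for l
    by (simp add: p_def poly_pcompose add.commute)
  have "p = 0 \<or> degree p < n"
  proof (cases "p = 0")
    case False
    have "degree p \<le> degree q"
      unfolding p_def by (rule degree_diff_le) (auto simp: degree_pcompose)
    \<comment> \<open>A shift of the argument preserves the leading coefficient, so it cancels in
      the difference.\<close>
    moreover have "coeff p (degree q) = 0"
      using lead_coeff_comp[of "[:1, 1 :: real:]" q] by (simp add: p_def degree_pcompose)
    then have "degree p \<noteq> degree q"
      using False by (metis leading_coeff_0_iff)
    moreover have "q \<noteq> 0"
      using False by (auto simp: p_def)
    ultimately show ?thesis
      using Suc.prems by auto
  qed simp
  from Suc.IH[OF this] have "0 = (\<Sum>l\<le>n. (-1) ^ l * of_nat (n choose l) * (poly q (of_nat l) - poly q (of_nat (Suc l))))"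
    by (simp add: poly_p)
  also have "\<dots> = (\<Sum>l\<le>n. (-1) ^ l * of_nat (n choose l) * poly q (of_nat l)) +
      (\<Sum>l\<le>n. (-1) ^ Suc l * of_nat (n choose l) * poly q (of_nat (Suc l)))"
    by (simp add: algebra_simps sum_subtractf sum_negf)
  also have "(\<Sum>l\<le>n. (-1) ^ l * of_nat (n choose l) * poly q (of_nat l)) =
      (\<Sum>l\<le>Suc n. (-1) ^ l * of_nat (n choose l) * poly q (of_nat l))"
    by simp
  also have "\<dots> = poly q 0 + (\<Sum>l\<le>n. (-1) ^ Suc l * of_nat (n choose Suc l) * poly q (of_nat (Suc l)))"
    by (subst sum.atMost_Suc_shift) simp
  also have "\<dots> + (\<Sum>l\<le>n. (-1) ^ Suc l * of_nat (n choose l) * poly q (of_nat (Suc l))) =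
      poly q 0 + (\<Sum>l\<le>n. (-1) ^ Suc l * of_nat (Suc n choose Suc l) * poly q (of_nat (Suc l)))"
    by (simp add: algebra_simps flip: sum.distrib)
  also have "\<dots> = (\<Sum>l\<le>Suc n. (-1) ^ l * of_nat (Suc n choose l) * poly q (of_nat l))"
    by (subst sum.atMost_Suc_shift) simp
  finally show ?case ..
qed

lemma poly_pochhammer:
  fixes p :: "'a :: comm_semiring_1 poly"
  shows "poly (pochhammer p k) x = pochhammer (poly p x) k"
  by (simp add: pochhammer_prod poly_prod)

lemma degree_pochhammer_linear_le: "degree (pochhammer [:c :: real, 1:] k) \<le> k"
proof -
  have "degree (pochhammer [:c, 1:] k) \<le> (\<Sum>i<k. degree ([:c, 1:] + of_nat i))"
    unfolding pochhammer_prod atLeast0LessThan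
    using degree_prod_sum_le[of "{..<k}" "\<lambda>i. [:c, 1:] + of_nat i"] by (simp add: comp_def)
  also have "\<dots> \<le> (\<Sum>i<k. 1)"
    by (intro sum_mono degree_add_le) auto
  finally show ?thesis by simp
qed

text \<open>These are the last \<open>k\<close> factors of \<open>pochhammer (x + 1) n\<close>, read
  downwards. They are what remains when coefficients are divided by the leading one.\<close>

lemma pochhammer_conv_descending_prod:
  assumes "k \<le> n"
  shows "pochhammer (of_nat x + 1 + of_nat (n - k) :: real) k = (\<Prod>i<k. of_nat (n + x - i))"
proof -
  have "pochhammer (of_nat x + 1 + of_nat (n - k) :: real) k = (\<Prod>i<k. of_nat x + 1 + of_nat (n - k) + of_nat i)"
    by (simp add: pochhammer_prod atLeast0LessThan)
  also have "\<dots> = (\<Prod>i<k. of_nat x + 1 + of_nat (n - k) + of_nat (k - Suc i))"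
    by (rule prod.nat_diff_reindex[symmetric])
  also have "\<dots> = (\<Prod>i<k. of_nat (n + x - i))"
    using assms by (intro prod.cong) (auto simp: of_nat_diff)
  finally show ?thesis .
qed

text \<open>\<open>fps_hypergeo\<close> multiplies its parameters by a fold over lists; the general
  start value \<open>c\<close> absorbs the extra numerator parameter.\<close>

lemma foldl_mult_map_interval:
  fixes f :: "'b \<Rightarrow> 'a :: comm_monoid_mult"
  shows "foldl (\<lambda>r x. r * f x) c (map g [1..<Suc r]) = c * (\<Prod>j=1..r. f (g j))"
  by (induction r) (simp_all add: mult_ac)

text \<open>The parameter \<open>- |n|\<close> and the factorial of the series combine to a signed
  binomial coefficient.\<close>

lemma coeff_mop_poly:
  fixes a b :: "nat \<Rightarrow> real"
  assumes "l \<le> multi_index_size r ns"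
  shows "coeff (mop_poly r ns a b) l =
    (-1) ^ l * of_nat (multi_index_size r ns choose l) *
      (\<Prod>j=1..r. pochhammer (b j + real (ns j) + 1) l / pochhammer (a j + 1) l)"
proof -
  let ?n = "multi_index_size r ns"
  have "pochhammer (- real ?n) l / fact l = (-1) ^ l * (real ?n gchoose l)"
    by (simp add: gbinomial_pochhammer)
  also have "\<dots> = (-1) ^ l * of_nat (?n choose l)"
    by (simp add: binomial_gbinomial)
  finally have "pochhammer (- real ?n) l = (-1) ^ l * of_nat (?n choose l) * fact l"
    by (simp add: field_simps)
  then show ?thesis
    using assms unfolding mop_poly_def
    by (simp add: foldl_mult_map_interval[unfolded One_nat_def] prod_dividef del: upt_Suc)
qed

lemma degree_mop_poly_le: "degree (mop_poly r ns a b) \<le> multi_index_size r ns"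
  unfolding mop_poly_def by (rule less_Suc_eq_le[THEN iffD1, OF degree_truncate_fps]) simp

lemma degree_mop_poly:
  assumes "\<And>j. j \<in> {1..r} \<Longrightarrow> a j \<ge> 0" "\<And>j. j \<in> {1..r} \<Longrightarrow> b j \<ge> 0"
  shows "degree (mop_poly r ns a b) = multi_index_size r ns"
proof (rule antisym[OF degree_mop_poly_le le_degree])
  have "pochhammer (b j + real (ns j) + 1) m / pochhammer (a j + 1) m > 0" if "j \<in> {1..r}" for j m
    using assms[OF that] by (intro divide_pos_pos pochhammer_pos add_nonneg_pos) auto
  then have "(\<Prod>j=1..r. pochhammer (b j + real (ns j) + 1) m / pochhammer (a j + 1) m) \<noteq> 0" for m
    by (intro order.strict_implies_not_eq[symmetric] prod_pos)
  then show "coeff (mop_poly r ns a b) (multi_index_size r ns) \<noteq> 0"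
    by (simp add: coeff_mop_poly)
qed

text \<open>Dividing coefficient \<open>n - k\<close> by the leading coefficient leaves the last
  \<open>k\<close> factors of each rising factorial, with numerators and denominators exchanged.
  Summing over \<open>k = n - l\<close> gives the form of the expected characteristic
  polynomial.\<close>

lemma poly_monic_rescaling_mop_poly:
  fixes a b :: "nat \<Rightarrow> nat"
  assumes n: "n = multi_index_size r ns"
  shows "poly (monic_rescaling (mop_poly r ns (\<lambda>j. real (a j)) (\<lambda>j. real (b j)))) x =
    (\<Sum>k\<le>n. (-1) ^ k * of_nat (n choose k) * x ^ (n - k) *
      (\<Prod>j=1..r. (\<Prod>i<k. of_nat (n + a j - i)) / (\<Prod>i<k. of_nat (n + ns j + b j - i))))"
proof -
  let ?P = "mop_poly r ns (\<lambda>j. real (a j)) (\<lambda>j. real (b j))"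
  let ?A = "\<lambda>j. pochhammer (real (a j) + 1)" and ?B = "\<lambda>j. pochhammer (real (b j) + real (ns j) + 1)"
  have deg: "degree ?P = n"
    using n by (simp add: degree_mop_poly)
  have lc: "lead_coeff ?P = (-1) ^ n * (\<Prod>j=1..r. ?B j n / ?A j n)"
    by (simp add: deg coeff_mop_poly n[symmetric])
  have pos: "?A j m > 0" "?B j m > 0" for j m
    by (intro pochhammer_pos; simp add: add_nonneg_pos)+
  have "poly (monic_rescaling ?P) x = (\<Sum>l\<le>n. coeff ?P l * x ^ l / lead_coeff ?P)"
    by (simp add: monic_rescaling_def poly_altdef deg sum_divide_distrib)
  also have "\<dots> = (\<Sum>k\<le>n. coeff ?P (n - k) * x ^ (n - k) / lead_coeff ?P)"
    by (rule sum.nat_diff_reindex[of _ "Suc n", folded lessThan_Suc_atMost, symmetric, simplified lessThan_Suc_atMost diff_Suc_Suc])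
  also have "\<dots> = (\<Sum>k\<le>n. (-1) ^ k * of_nat (n choose k) * x ^ (n - k) *
      (\<Prod>j=1..r. (\<Prod>i<k. of_nat (n + a j - i)) / (\<Prod>i<k. of_nat (n + ns j + b j - i))))"
  proof (intro sum.cong refl)
    fix k assume "k \<in> {..n}"
    then have k: "k \<le> n" by simp
    have ratio: "(?B j (n - k) / ?A j (n - k)) / (?B j n / ?A j n) =
        (\<Prod>i<k. of_nat (n + a j - i)) / (\<Prod>i<k. of_nat (n + ns j + b j - i))" for j
    proof -
      have "?A j n = ?A j (n - k) * (\<Prod>i<k. of_nat (n + a j - i))"
        using pochhammer_product[of "n - k" n "real (a j) + 1"] k
          pochhammer_conv_descending_prod[OF k, of "a j"] by simp
      moreover have "?B j n = ?B j (n - k) * (\<Prod>i<k. of_nat (n + ns j + b j - i))"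
        using pochhammer_product[of "n - k" n "real (b j) + real (ns j) + 1"] k
          pochhammer_conv_descending_prod[OF k, of "b j + ns j"] by (simp add: add_ac)
      ultimately show ?thesis
        using pos[of j "n - k"] by (simp add: field_simps)
    qed
    have sign: "(-1 :: real) ^ (n - k) / (-1) ^ n = (-1) ^ k"
      using k by (simp add: power_diff field_simps flip: power_mult_distrib)
    have coeff: "coeff ?P (n - k) = (-1) ^ (n - k) * of_nat (n choose k) * (\<Prod>j=1..r. ?B j (n - k) / ?A j (n - k))"
      using k binomial_symmetric[OF k] by (simp add: coeff_mop_poly n[symmetric])
    have quotient: "(s * c * X) / (t * Z) = u * c * (X / Z)" if "s / t = u" for s t u c X Z :: real
      using that by auto
    have "coeff ?P (n - k) / lead_coeff ?P =
        (-1) ^ k * of_nat (n choose k) * ((\<Prod>j=1..r. ?B j (n - k) / ?A j (n - k)) / (\<Prod>j=1..r. ?B j n / ?A j n))"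
      unfolding lc coeff by (rule quotient[OF sign])
    also have "(\<Prod>j=1..r. ?B j (n - k) / ?A j (n - k)) / (\<Prod>j=1..r. ?B j n / ?A j n) =
        (\<Prod>j=1..r. (\<Prod>i<k. of_nat (n + a j - i)) / (\<Prod>i<k. of_nat (n + ns j + b j - i)))"
      by (simp only: prod_dividef[symmetric] ratio)
    finally have coeff_ratio: "coeff ?P (n - k) / lead_coeff ?P = (-1) ^ k * of_nat (n choose k) *
      (\<Prod>j=1..r. (\<Prod>i<k. of_nat (n + a j - i)) / (\<Prod>i<k. of_nat (n + ns j + b j - i)))" .
    have "coeff ?P (n - k) * x ^ (n - k) / lead_coeff ?P = coeff ?P (n - k) / lead_coeff ?P * x ^ (n - k)"
      by simp
    then show "coeff ?P (n - k) * x ^ (n - k) / lead_coeff ?P =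
      (-1) ^ k * of_nat (n choose k) * x ^ (n - k) *
      (\<Prod>j=1..r. (\<Prod>i<k. of_nat (n + a j - i)) / (\<Prod>i<k. of_nat (n + ns j + b j - i)))"
      unfolding coeff_ratio by (simp only: mult_ac)
  qed
  finally show ?thesis .
qed

section \<open>Orthogonality of the hypergeometric polynomial\<close>

lemma Gamma_add_nat_plus_one:
  assumes "x \<ge> 0"
  shows "Gamma (x + 1 + real m) = Gamma (x + 1) * pochhammer (x + 1) m"
proof -
  have "x + 1 \<notin> \<int>\<^sub>\<le>\<^sub>0"
    using assms by (auto simp: nonpos_Ints_def)
  then have "pochhammer (x + 1) m = Gamma (x + 1 + real m) / Gamma (x + 1)"
    by (rule pochhammer_Gamma)
  moreover have "Gamma (x + 1) > 0"
    using assms by (intro Gamma_real_pos) simp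
  ultimately show ?thesis
    by (simp add: field_simps)
qed

text \<open>
  The left-hand side is the contribution of the index \<open>i\<close> to the \<open>l\<close>-th term of
  the integral against \<open>x ^ k\<close>; near the diagonal it is a polynomial in \<open>l\<close>.
\<close>

lemma Gamma_ratio_as_polynomial:
  assumes "a \<ge> 0" "b \<ge> 0" "k \<le> m"
  shows "pochhammer (b + real m + 1) l / pochhammer (a + 1) l *
      (Gamma (a + 1 + real (k + l)) / Gamma (b + 1 + real (k + l))) =
    Gamma (a + 1) / (Gamma (b + 1) * pochhammer (b + 1) m) *
      (pochhammer (a + 1 + real l) k * pochhammer (b + 1 + real (k + l)) (m - k))"
proof -
  have pos: "pochhammer (a + 1) l > 0" "pochhammer (b + 1) j > 0"
    "Gamma (a + 1) > 0" "Gamma (b + 1) > 0" for j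
    using assms by (intro pochhammer_pos Gamma_real_pos; simp)+
  have "pochhammer (a + 1) (k + l) = pochhammer (a + 1) l * pochhammer (a + 1 + real l) k"
    using pochhammer_product'[of "a + 1" l k] by (simp add: add.commute)
  moreover have "pochhammer (b + 1) m * pochhammer (b + real m + 1) l =
      pochhammer (b + 1) (k + l) * pochhammer (b + 1 + real (k + l)) (m - k)"
    using pochhammer_product'[of "b + 1" m l] pochhammer_product'[of "b + 1" "k + l" "m - k"] assms(3)
    by (simp add: add_ac)
  moreover have "Pb / Pa * ((GA * (Pa * X)) / (GB * PK)) = GA / (GB * PB) * (X * Q)"
    if "Pa > 0" "GB > 0" "PK > 0" "PB > 0" "PB * Pb = PK * Q" for Pa Pb PB PK GA GB X Q :: real
  proof -
    have "Pb = PK * Q / PB"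
      using that by (simp add: field_simps)
    then show ?thesis
      using that by (simp add: mult_ac)
  qed
  ultimately show ?thesis
    using pos by (simp only: Gamma_add_nat_plus_one[OF assms(1)] Gamma_add_nat_plus_one[OF assms(2)])
qed

text \<open>Near the diagonal \<open>k < ns j\<close> forces \<open>k \<le> ns i\<close> for all
  \<open>i\<close>, so index \<open>i\<close> contributes a polynomial in \<open>l\<close> of degree
  at most \<open>ns i\<close>. The factor \<open>1 / (s + b j)\<close> of the Mellin transform
  cancels one linear factor at \<open>i = j\<close>; the total degree is below \<open>n\<close> and
  the alternating binomial sum vanishes.\<close>

lemma mop_poly_moment_sum_eq_0:
  fixes a b :: "nat \<Rightarrow> real"
  assumes near: "near_diagonal r ns"
    and a: "\<And>j. j \<in> {1..r} \<Longrightarrow> a j \<ge> 0" and b: "\<And>j. j \<in> {1..r} \<Longrightarrow> b j \<ge> 0"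
    and j: "j \<in> {1..r}" and k: "k < ns j" and n: "n = multi_index_size r ns"
  shows "(\<Sum>l\<le>n. coeff (mop_poly r ns a b) l *
    (1 / (real (k + l) + 1 + b j) *
      (\<Prod>i=1..r. Gamma (real (k + l) + 1 + a i) / Gamma (real (k + l) + 1 + b i)))) = 0"
proof -
  have k_le: "k \<le> ns i" if "i \<in> {1..r}" for i
    using near j k that by (force simp: near_diagonal_def)
  \<comment> \<open>At \<open>i = j\<close> the first factor \<open>b j + 1 + k + l\<close> has been
    cancelled, so the rising factorial starts one later and is one shorter.\<close>
  define R where "R i = (if i = j then pochhammer [:b j + 2 + real k, 1:] (ns j - k - 1)
      else pochhammer [:b i + 1 + real k, 1:] (ns i - k))" for i
  define q where "q = (\<Prod>i=1..r. pochhammer [:a i + 1, 1:] k * R i)"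
  have "degree q \<le> (\<Sum>i=1..r. degree (pochhammer [:a i + 1, 1:] k * R i))"
    unfolding q_def by (rule order_trans[OF degree_prod_sum_le]) (simp_all only: comp_def finite_atLeastAtMost order_refl)
  also have "\<dots> \<le> (\<Sum>i=1..r. if i = j then ns i - 1 else ns i)"
  proof (rule sum_mono)
    fix i assume "i \<in> {1..r}"
    then have "degree (pochhammer [:a i + 1, 1:] k * R i) \<le> k + degree (R i)"
      by (intro order_trans[OF degree_mult_le] add_mono degree_pochhammer_linear_le order_refl)
    moreover have "degree (R i) \<le> (if i = j then ns i - k - 1 else ns i - k)"
      by (simp add: R_def degree_pochhammer_linear_le)
    ultimately show "degree (pochhammer [:a i + 1, 1:] k * R i) \<le> (if i = j then ns i - 1 else ns i)"
      using k k_le[OF \<open>i \<in> {1..r}\<close>] by (auto split: if_splits)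
  qed
  \<comment> \<open>Strict at \<open>i = j\<close>, because \<open>ns j > k\<close> is
    positive.\<close>
  also have "\<dots> < (\<Sum>i=1..r. ns i)"
    using j k by (intro sum_strict_mono_ex1) (auto intro!: bexI[of _ j])
  finally have deg: "degree q < n"
    by (simp add: n multi_index_size_def)
  define C where "C = (\<Prod>i=1..r. Gamma (a i + 1) / (Gamma (b i + 1) * pochhammer (b i + 1) (ns i)))"
  have term_eq: "coeff (mop_poly r ns a b) l *
      (1 / (real (k + l) + 1 + b j) *
        (\<Prod>i=1..r. Gamma (real (k + l) + 1 + a i) / Gamma (real (k + l) + 1 + b i))) =
    C * ((-1) ^ l * of_nat (n choose l) * poly q (of_nat l))" if "l \<le> n" for l
  proof -
    let ?g = "\<lambda>i. pochhammer (b i + 1 + real (k + l)) (ns i - k)"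
    have R_other: "poly (R i) (real l) = ?g i" if "i \<noteq> j" for i
      using that by (simp add: R_def poly_pochhammer add_ac)
    have nonneg: "b j \<ge> 0" using b[OF j] .
    have "?g j = pochhammer (b j + 1 + real (k + l)) (Suc (ns j - k - 1))"
      using k by (simp add: Suc_diff_Suc)
    also have "\<dots> = (b j + 1 + real (k + l)) * poly (R j) (real l)"
      unfolding pochhammer_rec by (simp add: R_def poly_pochhammer add_ac)
    finally have R_j: "poly (R j) (real l) = 1 / (real (k + l) + 1 + b j) * ?g j"
      using nonneg by (simp add: field_simps)
    have "1 / (real (k + l) + 1 + b j) * (\<Prod>i=1..r. ?g i) = (\<Prod>i=1..r. poly (R i) (real l))"
    proof -
      have "(\<Prod>i=1..r. poly (R i) (real l)) = poly (R j) (real l) * (\<Prod>i\<in>{1..r} - {j}. ?g i)"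
        using R_other by (subst prod.remove[OF finite_atLeastAtMost j]) (auto intro!: prod.cong)
      then show ?thesis
        unfolding R_j by (subst prod.remove[OF finite_atLeastAtMost j]) simp
    qed
    moreover have "(\<Prod>i=1..r. pochhammer (b i + real (ns i) + 1) l / pochhammer (a i + 1) l) *
        (\<Prod>i=1..r. Gamma (real (k + l) + 1 + a i) / Gamma (real (k + l) + 1 + b i)) =
      C * ((\<Prod>i=1..r. pochhammer (a i + 1 + real l) k) * (\<Prod>i=1..r. ?g i))"
      unfolding C_def prod.distrib[symmetric]
    proof (intro prod.cong refl)
      fix i assume i: "i \<in> {1..r}"
      show "pochhammer (b i + real (ns i) + 1) l / pochhammer (a i + 1) l *
          (Gamma (real (k + l) + 1 + a i) / Gamma (real (k + l) + 1 + b i)) =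
        Gamma (a i + 1) / (Gamma (b i + 1) * pochhammer (b i + 1) (ns i)) *
          (pochhammer (a i + 1 + real l) k * ?g i)"
        using Gamma_ratio_as_polynomial[OF a[OF i] b[OF i] k_le[OF i], of l] by (simp only: add_ac)
    qed
    moreover have "poly q (real l) = (\<Prod>i=1..r. pochhammer (a i + 1 + real l) k) * (\<Prod>i=1..r. poly (R i) (real l))"
      by (simp add: q_def poly_prod poly_pochhammer prod.distrib)
    moreover have "coeff (mop_poly r ns a b) l = (-1) ^ l * of_nat (n choose l) *
        (\<Prod>i=1..r. pochhammer (b i + real (ns i) + 1) l / pochhammer (a i + 1) l)"
      using that by (simp add: coeff_mop_poly n)
    moreover have "s * W * (F * G) = C * (s * (X * H))"
      if "F * g = H" "W * G = C * (X * g)" for s W F G g H X :: real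
    proof -
      have "s * W * (F * G) = s * F * (W * G)"
        by (simp only: mult_ac)
      then show ?thesis
        unfolding that(2) that(1)[symmetric] by (simp only: mult_ac)
    qed
    ultimately show ?thesis
      by (simp only:)
  qed
  have "(\<Sum>l\<le>n. C * ((-1) ^ l * of_nat (n choose l) * poly q (of_nat l))) = 0"
    using alternating_binomial_sum_poly_eq_0[of q n] deg by (simp flip: sum_distrib_left)
  then show ?thesis
    using term_eq by simp
qed

lemma mop_poly_type_II:
  fixes a b :: "nat \<Rightarrow> real"
  assumes near: "near_diagonal r ns"
    and a: "\<And>j. j \<in> {1..r} \<Longrightarrow> a j \<ge> 0" and b: "\<And>j. j \<in> {1..r} \<Longrightarrow> b j \<ge> 0"
    and w: "mop_weights r a b w"
  shows "type_II_mop r ns w (mop_poly r ns a b)"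
  unfolding type_II_mop_def
proof (intro conjI ballI allI impI degree_mop_poly_le)
  let ?P = "mop_poly r ns a b"
  let ?n = "multi_index_size r ns"
  have deg: "degree ?P = ?n"
    by (rule degree_mop_poly) (use a b in auto)
  have "coeff ?P 0 = 1"
    by (simp add: coeff_mop_poly)
  then show "?P \<noteq> 0" by auto
  fix j k assume j: "j \<in> {1..r}" and k: "k < ns j"
  \<comment> \<open>The moment of order \<open>k + l\<close> is the Mellin transform at
    \<open>s = k + l + 1\<close>; the exponent is kept in the form \<open>s - 1\<close> to match
    \<open>mop_weights\<close>.\<close>
  let ?f = "\<lambda>l x. x powr (real (k + l) + 1 - 1) * w j x"
  have w': "set_integrable lborel {0<..<1} (?f l)"
    "(LBINT x:{0<..<1}. ?f l x) = 1 / (real (k + l) + 1 + b j) *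
      (\<Prod>i=1..r. Gamma (real (k + l) + 1 + a i) / Gamma (real (k + l) + 1 + b i))" for l
  proof -
    have "\<forall>i\<in>{1..r}. real (k + l) + 1 + a i > 0"
      using a by (simp add: add_pos_nonneg)
    then show "set_integrable lborel {0<..<1} (?f l)"
      "(LBINT x:{0<..<1}. ?f l x) = 1 / (real (k + l) + 1 + b j) *
        (\<Prod>i=1..r. Gamma (real (k + l) + 1 + a i) / Gamma (real (k + l) + 1 + b i))"
      using w j unfolding mop_weights_def by blast+
  qed
  have "(LBINT x:{0<..<1}. poly ?P x * x ^ k * w j x) = (LBINT x:{0<..<1}. (\<Sum>l\<le>?n. coeff ?P l * ?f l x))"
  proof (rule set_lebesgue_integral_cong)
    show "\<forall>x. x \<in> {0<..<1} \<longrightarrow> poly ?P x * x ^ k * w j x = (\<Sum>l\<le>?n. coeff ?P l * ?f l x)"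
    proof (intro allI impI)
      fix x :: real assume "x \<in> {0<..<1}"
      then have "x powr (real (k + l) + 1 - 1) = x ^ k * x ^ l" for l
        by (simp add: powr_realpow power_add flip: of_nat_add)
      moreover have "poly ?P x = (\<Sum>l\<le>?n. coeff ?P l * x ^ l)"
        by (simp add: poly_altdef deg)
      ultimately show "poly ?P x * x ^ k * w j x = (\<Sum>l\<le>?n. coeff ?P l * ?f l x)"
        by (simp add: sum_distrib_left sum_distrib_right mult_ac)
    qed
  qed simp
  also have "\<dots> = (\<Sum>l\<le>?n. coeff ?P l * (LBINT x:{0<..<1}. ?f l x))"
  proof -
    have "(LBINT x:{0<..<1}. (\<Sum>l\<le>?n. coeff ?P l * ?f l x)) =
        (LBINT x. (\<Sum>l\<le>?n. coeff ?P l * (indicator {0<..<1} x *\<^sub>R ?f l x)))"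
      by (simp add: set_lebesgue_integral_def sum_distrib_left mult_ac)
    also have "\<dots> = (\<Sum>l\<le>?n. LBINT x. coeff ?P l * (indicator {0<..<1} x *\<^sub>R ?f l x))"
      using w'(1) unfolding set_integrable_def
      by (intro Bochner_Integration.integral_sum integrable_mult_right)
    finally show ?thesis
      by (simp add: set_lebesgue_integral_def)
  qed
  also have "\<dots> = 0"
    unfolding w'(2) by (rule mop_poly_moment_sum_eq_0[OF near a b j k refl])
  finally show "(LBINT x:{0<..<1}. poly ?P x * x ^ k * w j x) = 0" .
qed

subsection \<open>Average characteristic polynomial\<close>

theorem corollary5p4:
  fixes M :: "'w measure"
    and r n :: nat
    and ns a b :: "nat \<Rightarrow> nat"
    and U T :: "nat \<Rightarrow> 'w \<Rightarrow> complex mat"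
  assumes "r \<ge> 1"
    and "near_diagonal r ns"
    and "n = multi_index_size r ns"
    and "n \<ge> 1"
    and "\<And>j. j \<in> {1..r} \<Longrightarrow> b j \<ge> (n - ns 1) * of_bool (j = 1) + a j"
    and "a 0 = 0"
    and "\<And>j. j \<in> {1..r} \<Longrightarrow> n + a j \<le> n + ns j + b j \<and> n + a (j - 1) \<le> n + ns j + b j"
    and "prob_space M"
    and "\<And>j. j \<in> {1..r} \<Longrightarrow> haar_distributed M (n + ns j + b j) (U j)"
    and "\<And>j \<omega>. j \<in> {1..r} \<Longrightarrow> \<omega> \<in> space M \<Longrightarrow>
           T j \<omega> = truncation (n + a j) (n + a (j - 1)) (U j \<omega>)"
    and "prob_space.indep_vars M (\<lambda>j. mat_borel (n + a j) (n + a (j - 1))) T {1..r}"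
  shows "(\<forall>x::real.
            integrable M (\<lambda>\<omega>. \<Prod>y\<in>#squared_singular_values (mat_product n (\<lambda>j. T j \<omega>) r). x - y) \<and>
            prob_space.expectation M
              (\<lambda>\<omega>. \<Prod>y\<in>#squared_singular_values (mat_product n (\<lambda>j. T j \<omega>) r). x - y) =
            poly (monic_rescaling (mop_poly r ns (\<lambda>j. real (a j)) (\<lambda>j. real (b j)))) x) \<and>
         (\<forall>w. mop_weights r (\<lambda>j. real (a j)) (\<lambda>j. real (b j)) w \<longrightarrow>
            type_II_mop r ns w (mop_poly r ns (\<lambda>j. real (a j)) (\<lambda>j. real (b j))))"
proof -
  interpret prob_space M by fact
  \<comment> \<open>One sequence for all matrix dimensions; \<open>a 0 = 0\<close> makes its start
    \<open>d 0\<close> the number of columns of the product.\<close>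
  define d where "d j = n + a j" for j
  have d0: "d 0 = n"
    using \<open>a 0 = 0\<close> by (simp add: d_def)
  have N: "d j \<le> n + ns j + b j \<and> d (j - 1) \<le> n + ns j + b j" if "j \<in> {1..r}" for j
    using assms(7)[OF that] by (simp add: d_def)
  have T: "T j \<omega> = truncation (d j) (d (j - 1)) (U j \<omega>)" if "j \<in> {1..r}" "\<omega> \<in> space M" for j \<omega>
    using assms(10)[OF that] by (simp add: d_def)
  have indep: "indep_vars (\<lambda>j. mat_borel (d j) (d (j - 1))) T {1..r}"
    using assms(11) by (simp add: d_def)
  \<comment> \<open>Orthogonality holds for every family of functions with the prescribed Mellin
    transforms, which identifies \<open>mop_poly\<close> as the multiple orthogonal
    polynomial.\<close>
  have "type_II_mop r ns w (mop_poly r ns (\<lambda>j. real (a j)) (\<lambda>j. real (b j)))"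
    if "mop_weights r (\<lambda>j. real (a j)) (\<lambda>j. real (b j)) w" for w
    using assms(2) _ _ that by (rule mop_poly_type_II) auto
  moreover have "integrable M (\<lambda>\<omega>. \<Prod>y\<in>#squared_singular_values (mat_product n (\<lambda>j. T j \<omega>) r). x - y)" for x
    unfolding d0[symmetric]
    by (rule integrable_char_poly_truncations[where N = "\<lambda>j. n + ns j + b j" and U = U, OF _ _ _ indep])
       (rule N assms(9) T; assumption)+
  moreover have "expectation (\<lambda>\<omega>. \<Prod>y\<in>#squared_singular_values (mat_product n (\<lambda>j. T j \<omega>) r). x - y) =
      poly (monic_rescaling (mop_poly r ns (\<lambda>j. real (a j)) (\<lambda>j. real (b j)))) x" for x
  proof -
    have "expectation (\<lambda>\<omega>. \<Prod>y\<in>#squared_singular_values (mat_product (d 0) (\<lambda>j. T j \<omega>) r). x - y) =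
        (\<Sum>k\<le>d 0. (-1) ^ k * of_nat (d 0 choose k) * x ^ (d 0 - k) *
          (\<Prod>j=1..r. (\<Prod>i<k. of_nat (d j - i)) / (\<Prod>i<k. of_nat (n + ns j + b j - i))))"
      by (rule expectation_char_poly_truncations[where N = "\<lambda>j. n + ns j + b j" and U = U, OF _ _ _ indep])
         (rule N assms(9) T; assumption)+
    then show ?thesis
      unfolding poly_monic_rescaling_mop_poly[OF assms(3)] d0 unfolding d_def .
  qed
  ultimately show ?thesis
    by blast
qed

end
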